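(* For every $n\ge1$ there are bijections $\Phi_1:\mathfrak S_n\to\mathfrak S_n$ and $\Phi_2:\mathfrak S_n\to\mathfrak S_n$ such that for all $\sigma\in\mathfrak S_n$, $$(\mathrm{des},\mathrm{des}_2)\,\sigma=(\mathrm{exc},\mathrm{ear})\,\Phi_1(\sigma),$$ $$(\mathrm{des},\mathrm{des}_2,\mathrm{fmax})\,\sigma=(\mathrm{exc},\mathrm{pex},\mathrm{fix})\,\Phi_2(\sigma).$$
   Context: $\mathfrak S_n$ is the set of permutations of $[n]=\{1,\dots,n\}$; $(s_1,s_2,\dots)\,\sigma$ denotes $(s_1(\sigma),s_2(\sigma),\dots)$. For $\sigma\in\mathfrak S_n$: - $\mathrm{des}\,\sigma$ is the number of descents, i.e. $i\in[1,n-1]$ with $\sigma(i)>\sigma(i+1)$; $\mathrm{des}_2\,\sigma$ is the number of descents $i$ with $\sigma(j)<\sigma(i)$ for all $j<i$. - $\mathrm{exc}\,\sigma$ is the number of $i$ with $\sigma(i)>i$; $\mathrm{pex}\,\sigma$ is the number of $i$ with $\sigma(i)>i$ and $\sigma(j)\notin[i,\sigma(i)]$ for all $j<i$; $\mathrm{fix}\,\sigma$ is the number of fixed points. - An index $i$ (or the value $\sigma(i)$) is a record if $\sigma(j)<\sigma(i)$ for all $j<i$; an antirecord if $\sigma(j)>\sigma(i)$ for all $j>i$; an exclusive antirecord if it is an antirecord and not a record; $i$ is a cycle peak if $\sigma^{-1}(i)<i>\sigma(i)$. $\mathrm{ear}\,\sigma$ is the number of $i$ that are both an exclusive antirecord and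 a cycle peak. - With $\sigma(0)=0$, $\sigma(n+1)=n+1$, the value $\sigma(i)$ ($1\le i\le n$) is a double ascent if $\sigma(i-1)<\sigma(i)<\sigma(i+1)$; a foremaximum is a double ascent that is also a record; $\mathrm{fmax}\,\sigma$ is the number of foremaxima. *)

theory Defs
  imports "HOL-Combinatorics.Permutations"
begin

text \<open>
  Permutations of \<open>[n]\<close> are functions \<open>\<sigma>\<close> on the natural numbers with \<open>\<sigma> permutes {1..n}\<close>.
  Such a \<open>\<sigma>\<close> is the identity outside \<open>{1..n}\<close>, so the boundary conventions
  \<open>\<sigma>(0) = 0\<close> and \<open>\<sigma>(n+1) = n+1\<close> hold automatically.
\<close>

definition Sym :: "nat \<Rightarrow> (nat \<Rightarrow> nat) set" where
  "Sym n = {\<sigma>. \<sigma> permutes {1..n}}"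

definition descent :: "nat \<Rightarrow> (nat \<Rightarrow> nat) \<Rightarrow> nat \<Rightarrow> bool" where
  "descent n \<sigma> i \<longleftrightarrow> i \<in> {1..<n} \<and> \<sigma> i > \<sigma> (i + 1)"

definition excedance :: "nat \<Rightarrow> (nat \<Rightarrow> nat) \<Rightarrow> nat \<Rightarrow> bool" where
  "excedance n \<sigma> i \<longleftrightarrow> i \<in> {1..n} \<and> \<sigma> i > i"

definition is_record :: "nat \<Rightarrow> (nat \<Rightarrow> nat) \<Rightarrow> nat \<Rightarrow> bool" where
  "is_record n \<sigma> i \<longleftrightarrow> i \<in> {1..n} \<and> (\<forall>j\<in>{1..<i}. \<sigma> j < \<sigma> i)"

definition antirecord :: "nat \<Rightarrow> (nat \<Rightarrow> nat) \<Rightarrow> nat \<Rightarrow> bool" where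
  "antirecord n \<sigma> i \<longleftrightarrow> i \<in> {1..n} \<and> (\<forall>j\<in>{i<..n}. \<sigma> j > \<sigma> i)"

definition exclusive_antirecord :: "nat \<Rightarrow> (nat \<Rightarrow> nat) \<Rightarrow> nat \<Rightarrow> bool" where
  "exclusive_antirecord n \<sigma> i \<longleftrightarrow> antirecord n \<sigma> i \<and> \<not> is_record n \<sigma> i"

definition cycle_peak :: "nat \<Rightarrow> (nat \<Rightarrow> nat) \<Rightarrow> nat \<Rightarrow> bool" where
  "cycle_peak n \<sigma> i \<longleftrightarrow> i \<in> {1..n} \<and> inv \<sigma> i < i \<and> i > \<sigma> i"

text \<open>Double ascents and foremaxima are values \<open>\<sigma> i\<close>; they are identified by their index \<open>i\<close>.\<close>

definition double_ascent :: "nat \<Rightarrow> (nat \<Rightarrow> nat) \<Rightarrow> nat \<Rightarrow> bool" where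
  "double_ascent n \<sigma> i \<longleftrightarrow> i \<in> {1..n} \<and> \<sigma> (i - 1) < \<sigma> i \<and> \<sigma> i < \<sigma> (i + 1)"

definition foremaximum :: "nat \<Rightarrow> (nat \<Rightarrow> nat) \<Rightarrow> nat \<Rightarrow> bool" where
  "foremaximum n \<sigma> i \<longleftrightarrow> double_ascent n \<sigma> i \<and> is_record n \<sigma> i"

definition des :: "nat \<Rightarrow> (nat \<Rightarrow> nat) \<Rightarrow> nat" where
  "des n \<sigma> = card {i. descent n \<sigma> i}"

definition des2 :: "nat \<Rightarrow> (nat \<Rightarrow> nat) \<Rightarrow> nat" where
  "des2 n \<sigma> = card {i. descent n \<sigma> i \<and> (\<forall>j\<in>{1..<i}. \<sigma> j < \<sigma> i)}"

definition exc :: "nat \<Rightarrow> (nat \<Rightarrow> nat) \<Rightarrow> nat" where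
  "exc n \<sigma> = card {i. excedance n \<sigma> i}"

definition pex :: "nat \<Rightarrow> (nat \<Rightarrow> nat) \<Rightarrow> nat" where
  "pex n \<sigma> = card {i. excedance n \<sigma> i \<and> (\<forall>j\<in>{1..<i}. \<sigma> j \<notin> {i..\<sigma> i})}"

text \<open>The index range excludes the trivial fixed points outside \<open>{1..n}\<close>.\<close>

definition fixpts :: "nat \<Rightarrow> (nat \<Rightarrow> nat) \<Rightarrow> nat" where
  "fixpts n \<sigma> = card {i \<in> {1..n}. \<sigma> i = i}"

definition ear :: "nat \<Rightarrow> (nat \<Rightarrow> nat) \<Rightarrow> nat" where
  "ear n \<sigma> = card {i. exclusive_antirecord n \<sigma> i \<and> cycle_peak n \<sigma> i}"

definition fmax :: "nat \<Rightarrow> (nat \<Rightarrow> nat) \<Rightarrow> nat" where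
  "fmax n \<sigma> = card {i. foremaximum n \<sigma> i}"

end

theory Submission
  imports Defs
begin

text \<open>
  The triples \<open>(des, des\<^sub>2, fmax)\<close>, \<open>(exc, ear, fix)\<close> and \<open>(exc, pex, fix)\<close> are equidistributed because
  their distributions obey the same recurrence. A permutation of \<open>[n+1]\<close> arises by inserting a new minimum into a word on \<open>n\<close> letters,
  which acts on \<open>(des, des\<^sub>2, fmax)\<close> by the case \<open>h = 0\<close> of an operator \<open>M\<^sub>n\<close>. The other two triples
  are instead followed along the restrictions of the graph of \<open>\<sigma>\<close> to
  \<open>[k] \<times> [k]\<close>, where \<open>h\<close> counts the indices without an image (a Laguerre history); passing from \<open>k\<close> to
  \<open>k + 1\<close> is an operator \<open>L\<close> that does not depend on \<open>k\<close>. Among the \<open>h\<^sup>2\<close> ways of making \<open>k + 1\<close> a cycle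
  peak, exactly \<open>h\<close> are counted: those taking the least open value for ear, and those taking the largest open
  source for pex (after reflecting the permutation matrix in the antidiagonal). Since
  \<open>L M\<^bsub>n+1\<^esub> = M\<^sub>n L\<close>, the histories satisfy the insertion recurrence as well.
\<close>

text \<open>The arguments \<open>h\<close>, \<open>e\<close>, \<open>q\<close>, \<open>f\<close> count open positions, excedances, marked cycle peaks and fixed points.
  Integer arguments make the commutation an identity without side conditions at the boundary.\<close>

definition history_step :: "(int \<Rightarrow> int \<Rightarrow> int \<Rightarrow> int \<Rightarrow> int) \<Rightarrow> int \<Rightarrow> int \<Rightarrow> int \<Rightarrow> int \<Rightarrow> int" where
  "history_step g h e q f = g (h + 1) e q f + g h e q (f + 1) + h * g h (e + 1) q f + h * g h e q f
     + h * g (h - 1) (e + 1) (q + 1) f + h * (h - 1) * g (h - 1) (e + 1) q f"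

definition insertion_step :: "nat \<Rightarrow> (int \<Rightarrow> int \<Rightarrow> int \<Rightarrow> int \<Rightarrow> int) \<Rightarrow> int \<Rightarrow> int \<Rightarrow> int \<Rightarrow> int \<Rightarrow> int" where
  "insertion_step n g h e q f = g (h + 1) e q f + g h e q (f + 1) + (h + e) * g h e q f
     + f * g h (e + 1) (q + 1) (f - 1) + (int n - e - f) * g h (e + 1) q f"

text \<open>Both sides are integer combinations of shifts of \<open>g\<close>, and their
  coefficients agree. As \<open>insertion_step (Suc n)\<close> exceeds
  \<open>insertion_step n\<close> by the shift of \<open>e\<close>, the identity says that the
  commutator of \<open>insertion_step n\<close> with \<open>history_step\<close> is
  \<open>history_step\<close> composed with that shift.\<close>

lemma history_insertion_commute:
  "history_step (insertion_step (Suc n) g) = insertion_step n (history_step g)"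
  by (intro ext) (simp add: history_step_def insertion_step_def algebra_simps)

subsection \<open>Partial permutations\<close>

definition partial_perms :: "nat \<Rightarrow> (nat \<times> nat) set set" where
  "partial_perms n = {R. R \<subseteq> {1..n} \<times> {1..n} \<and> single_valued R \<and> single_valued (R\<inverse>)}"

definition open_sources :: "nat \<Rightarrow> (nat \<times> nat) set \<Rightarrow> nat set" where
  "open_sources n R = {1..n} - Domain R"

definition open_values :: "nat \<Rightarrow> (nat \<times> nat) set \<Rightarrow> nat set" where
  "open_values n R = {1..n} - Range R"

text \<open>The possible sets of edges at \<open>Suc n\<close>: none, a loop, one edge into it, one
  edge out of it, or one of each. Their numbers 1, 1, h, h, h^2 become the coefficients of
  \<open>history_step\<close>.\<close>

definition extensions :: "nat \<Rightarrow> (nat \<times> nat) set \<Rightarrow> (nat \<times> nat) set set" where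
  "extensions n R = {{}, {(Suc n, Suc n)}} \<union> (\<lambda>i. {(i, Suc n)}) ` open_sources n R
     \<union> (\<lambda>v. {(Suc n, v)}) ` open_values n R
     \<union> (\<lambda>(i, v). {(i, Suc n), (Suc n, v)}) ` (open_sources n R \<times> open_values n R)"

lemma partial_perms_subset: "R \<in> partial_perms n \<Longrightarrow> R \<subseteq> {1..n} \<times> {1..n}"
  by (simp add: partial_perms_def)

lemma finite_partial_perms: "finite (partial_perms n)"
proof -
  have "partial_perms n \<subseteq> Pow ({1..n} \<times> {1..n})"
    by (auto simp: partial_perms_def)
  then show ?thesis by (rule finite_subset) simp
qed

lemma finite_partial_perm: "R \<in> partial_perms n \<Longrightarrow> finite R"
  using partial_perms_subset finite_subset by blast

lemma card_Domain_partial_perm: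
  assumes "R \<in> partial_perms n" shows "card (Domain R) = card R"
proof -
  have "inj_on fst R"
    using assms by (auto simp: partial_perms_def inj_on_def single_valued_def)
  then show ?thesis by (metis card_image fst_eq_Domain)
qed

lemma card_Range_partial_perm:
  assumes "R \<in> partial_perms n" shows "card (Range R) = card R"
proof -
  have "inj_on snd R"
    using assms by (auto simp: partial_perms_def inj_on_def single_valued_def)
  then show ?thesis by (metis card_image snd_eq_Range)
qed

lemma card_open_sources:
  assumes "R \<in> partial_perms n" shows "int (card (open_sources n R)) = int n - int (card R)"
proof -
  have "Domain R \<subseteq> {1..n}" using partial_perms_subset[OF assms] by auto
  then show ?thesis
    using card_Domain_partial_perm[OF assms] card_mono[of "{1..n}" "Domain R"]
    by (simp add: open_sources_def card_Diff_subset finite_subset of_nat_diff)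
qed

lemma card_open_values:
  assumes "R \<in> partial_perms n" shows "int (card (open_values n R)) = int n - int (card R)"
proof -
  have "Range R \<subseteq> {1..n}" using partial_perms_subset[OF assms] by auto
  then show ?thesis
    using card_Range_partial_perm[OF assms] card_mono[of "{1..n}" "Range R"]
    by (simp add: open_values_def card_Diff_subset finite_subset of_nat_diff)
qed

lemma extension_outside: "D \<in> extensions n R \<Longrightarrow> D \<inter> {1..n} \<times> {1..n} = {}"
  by (auto simp: extensions_def open_sources_def open_values_def)

lemma partial_permsI:
  assumes "\<And>a b. (a, b) \<in> R \<Longrightarrow> a \<in> {1..n} \<and> b \<in> {1..n}"
    and "\<And>a b c d. (a, b) \<in> R \<Longrightarrow> (c, d) \<in> R \<Longrightarrow> a = c \<longleftrightarrow> b = d"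
  shows "R \<in> partial_perms n"
  unfolding partial_perms_def single_valued_def mem_Collect_eq converse_iff
  by (intro conjI subrelI allI impI) (use assms in fast)+

lemma partial_permsD:
  assumes "R \<in> partial_perms n"
  shows "(a, b) \<in> R \<Longrightarrow> a \<in> {1..n} \<and> b \<in> {1..n}"
    and "(a, b) \<in> R \<Longrightarrow> (c, d) \<in> R \<Longrightarrow> a = c \<longleftrightarrow> b = d"
  using assms unfolding partial_perms_def single_valued_def by auto

lemma extension_partial_perm:
  assumes R: "R \<in> partial_perms n" and D: "D \<in> extensions n R"
  shows "R \<union> D \<in> partial_perms (Suc n)"
proof (rule partial_permsI)
  have D1: "a \<in> {1..Suc n} \<and> b \<in> {1..Suc n}" if "(a, b) \<in> D" for a b
    using that D unfolding extensions_def open_sources_def open_values_def by auto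
  have D2: "a = c \<longleftrightarrow> b = d" if "(a, b) \<in> D" "(c, d) \<in> D" for a b c d
    using that D unfolding extensions_def open_sources_def open_values_def by auto
  have D3: "a \<notin> Domain R \<and> b \<notin> Range R" if "(a, b) \<in> D" for a b
    using that D partial_permsD(1)[OF R]
    unfolding extensions_def open_sources_def open_values_def by fastforce
  fix a b c d
  show "a \<in> {1..Suc n} \<and> b \<in> {1..Suc n}" if "(a, b) \<in> R \<union> D"
    using that D1 partial_permsD(1)[OF R, of a b] by auto
  show "a = c \<longleftrightarrow> b = d" if "(a, b) \<in> R \<union> D" "(c, d) \<in> R \<union> D"
    using that D2 D3 partial_permsD(2)[OF R] by blast
qed

lemma partial_perm_restrict:
  "R \<in> partial_perms m \<Longrightarrow> R \<inter> {1..n} \<times> {1..n} \<in> partial_perms n"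
  unfolding partial_perms_def single_valued_def by blast

text \<open>The edges outside the box of side \<open>n\<close> are those touching
  \<open>Suc n\<close>. Single-valuedness in both directions allows at most one in and one out, and
  their other ends are open in the restriction.\<close>

lemma partial_perm_extension:
  assumes "R \<in> partial_perms (Suc n)"
  shows "R - {1..n} \<times> {1..n} \<in> extensions n (R \<inter> {1..n} \<times> {1..n})"
proof -
  let ?k = "Suc n"
  have sub: "R \<subseteq> {1..?k} \<times> {1..?k}" by (rule partial_perms_subset[OF assms])
  have sv: "\<And>a b c. (a, b) \<in> R \<Longrightarrow> (a, c) \<in> R \<Longrightarrow> b = c"
    and svc: "\<And>a b c. (a, c) \<in> R \<Longrightarrow> (b, c) \<in> R \<Longrightarrow> a = b"
    using assms by (auto simp: partial_perms_def single_valued_def)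
  have out: "(a, b) \<in> R - {1..n} \<times> {1..n} \<longleftrightarrow> (a, b) \<in> R \<and> (a = ?k \<or> b = ?k)" for a b
    using sub by (auto simp: le_Suc_eq)
  have src: "i \<in> open_sources n (R \<inter> {1..n} \<times> {1..n})" if "(i, ?k) \<in> R" "i \<noteq> ?k" for i
    using that sub by (auto simp: open_sources_def dest: sv)
  have val: "v \<in> open_values n (R \<inter> {1..n} \<times> {1..n})" if "(?k, v) \<in> R" "v \<noteq> ?k" for v
    using that sub by (auto simp: open_values_def dest: svc)
  \<comment> \<open>A loop uses up both edges at \<open>?k\<close>; otherwise the incoming and the
    outgoing edge may be present or absent independently.\<close>
  consider "(?k, ?k) \<in> R"
    | "?k \<notin> Domain R" "?k \<notin> Range R"
    | i where "(i, ?k) \<in> R" "i \<noteq> ?k" "?k \<notin> Domain R"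
    | v where "(?k, v) \<in> R" "v \<noteq> ?k" "?k \<notin> Range R"
    | i v where "(i, ?k) \<in> R" "i \<noteq> ?k" "(?k, v) \<in> R" "v \<noteq> ?k"
    by (metis DomainE RangeE)
  then show ?thesis
  proof cases
    case 1
    have "(a, b) \<in> R - {1..n} \<times> {1..n} \<longleftrightarrow> (a, b) \<in> {(?k, ?k)}" for a b
      using 1 unfolding out by (auto dest: sv svc)
    then have "R - {1..n} \<times> {1..n} = {(?k, ?k)}"
      by (intro set_eqI) (simp only: split_paired_all)
    then show ?thesis by (simp add: extensions_def)
  next
    case 2
    have "(a, b) \<notin> R - {1..n} \<times> {1..n}" for a b
      using 2 unfolding out by auto
    then have "R - {1..n} \<times> {1..n} = {}" by auto
    then show ?thesis by (simp add: extensions_def)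
  next
    case (3 i)
    have "(a, b) \<in> R - {1..n} \<times> {1..n} \<longleftrightarrow> (a, b) \<in> {(i, ?k)}" for a b
      using 3 unfolding out by (auto dest: sv svc)
    then have "R - {1..n} \<times> {1..n} = {(i, ?k)}"
      by (intro set_eqI) (simp only: split_paired_all)
    then show ?thesis using src[OF 3(1,2)] by (auto simp: extensions_def)
  next
    case (4 v)
    have "(a, b) \<in> R - {1..n} \<times> {1..n} \<longleftrightarrow> (a, b) \<in> {(?k, v)}" for a b
      using 4 unfolding out by (auto dest: sv svc)
    then have "R - {1..n} \<times> {1..n} = {(?k, v)}" by (intro set_eqI) (simp only: split_paired_all)
    then show ?thesis using val[OF 4(1,2)] by (auto simp: extensions_def)
  next
    case (5 i v)
    have "(a, b) \<in> R - {1..n} \<times> {1..n} \<longleftrightarrow> (a, b) \<in> {(i, ?k), (?k, v)}" for a b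
      using 5 unfolding out by (auto dest: sv svc)
    then have "R - {1..n} \<times> {1..n} = {(i, ?k), (?k, v)}"
      by (intro set_eqI) (simp only: split_paired_all)
    then show ?thesis using src[OF 5(1,2)] val[OF 5(3,4)] by (auto simp: extensions_def)
  qed
qed

section \<open>Summation over the partial permutations of [n+1]\<close>

lemma finite_extensions: "finite (extensions n R)"
  by (simp add: extensions_def open_sources_def open_values_def)

text \<open>Cutting at the box of side \<open>n\<close> is inverse to adding an extension, so each
  partial permutation of [n+1] is counted once.\<close>

lemma sum_partial_perms_Suc:
  fixes G :: "(nat \<times> nat) set \<Rightarrow> int"
  shows "sum G (partial_perms (Suc n)) = (\<Sum>R\<in>partial_perms n. \<Sum>D\<in>extensions n R. G (R \<union> D))"
proof -
  have "sum G (partial_perms (Suc n)) =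
      (\<Sum>(R, D)\<in>Sigma (partial_perms n) (extensions n). G (R \<union> D))"
  proof (rule sum.reindex_bij_witness[where i = "\<lambda>(R, D). R \<union> D"
        and j = "\<lambda>R. (R \<inter> {1..n} \<times> {1..n}, R - {1..n} \<times> {1..n})"])
    fix x assume "x \<in> Sigma (partial_perms n) (extensions n)"
    then obtain R D where x: "x = (R, D)" "R \<in> partial_perms n" "D \<in> extensions n R" by auto
    show "((case x of (R, D) \<Rightarrow> R \<union> D) \<inter> {1..n} \<times> {1..n}, (case x of (R, D) \<Rightarrow> R \<union> D) - {1..n} \<times> {1..n}) = x"
      using extension_outside[OF x(3)] partial_perms_subset[OF x(2)] unfolding x by auto
    show "(case x of (R, D) \<Rightarrow> R \<union> D) \<in> partial_perms (Suc n)"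
      using extension_partial_perm x by simp
  next
    fix R assume R: "R \<in> partial_perms (Suc n)"
    show "(R \<inter> {1..n} \<times> {1..n}, R - {1..n} \<times> {1..n}) \<in> Sigma (partial_perms n) (extensions n)"
      using partial_perm_extension[OF R] partial_perm_restrict[OF R] by blast
  qed (simp_all add: Int_Diff_Un)
  also have "\<dots> = (\<Sum>R\<in>partial_perms n. \<Sum>D\<in>extensions n R. G (R \<union> D))"
    by (subst sum.Sigma) (auto simp: finite_partial_perms finite_extensions)
  finally show ?thesis .
qed

lemma sum_extensions:
  fixes G :: "(nat \<times> nat) set \<Rightarrow> int"
  shows "(\<Sum>D\<in>extensions n R. G D) = G {} + G {(Suc n, Suc n)}
    + (\<Sum>i\<in>open_sources n R. G {(i, Suc n)}) + (\<Sum>v\<in>open_values n R. G {(Suc n, v)})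
    + (\<Sum>(i, v)\<in>open_sources n R \<times> open_values n R. G {(i, Suc n), (Suc n, v)})"
proof -
  let ?k = "Suc n" and ?O = "open_sources n R" and ?V = "open_values n R"
  have fin: "finite ?O" "finite ?V"
    by (simp_all add: open_sources_def open_values_def)
  \<comment> \<open>\<open>?k\<close> is never open, so the five kinds of extension are pairwise
    disjoint and different choices of \<open>i\<close> and \<open>v\<close> give different edge
    sets.\<close>
  have ne: "?k \<notin> ?O" "?k \<notin> ?V"
    by (simp_all add: open_sources_def open_values_def)
  let ?A = "(\<lambda>i. {(i, ?k)}) ` ?O" and ?B = "(\<lambda>v. {(?k, v)}) ` ?V"
    and ?C = "(\<lambda>(i, v). {(i, ?k), (?k, v)}) ` (?O \<times> ?V)"
  have "sum G (extensions n R) = sum G ({{}, {(?k, ?k)}} \<union> ?A \<union> ?B) + sum G ?C"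
    unfolding extensions_def using fin ne by (intro sum.union_disjoint) (auto simp: doubleton_eq_iff)
  also have "sum G ({{}, {(?k, ?k)}} \<union> ?A \<union> ?B) = sum G ({{}, {(?k, ?k)}} \<union> ?A) + sum G ?B"
    using fin ne by (intro sum.union_disjoint) auto
  also have "sum G ({{}, {(?k, ?k)}} \<union> ?A) = sum G {{}, {(?k, ?k)}} + sum G ?A"
    using fin ne by (intro sum.union_disjoint) auto
  finally have "sum G (extensions n R) = sum G {{}, {(?k, ?k)}} + sum G ?A + sum G ?B + sum G ?C" .
  moreover have "sum G ?A = (\<Sum>i\<in>?O. G {(i, ?k)})" "sum G ?B = (\<Sum>v\<in>?V. G {(?k, v)})"
    by (subst sum.reindex; auto simp: inj_on_def)+
  moreover have "sum G ?C = (\<Sum>(i, v)\<in>?O \<times> ?V. G {(i, ?k), (?k, v)})"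
    using ne by (subst sum.reindex) (auto simp: inj_on_def doubleton_eq_iff case_prod_beta)
  ultimately show ?thesis by simp
qed

section \<open>Excedances, fixed points and marked peaks along a history\<close>

definition exc_pairs :: "(nat \<times> nat) set \<Rightarrow> nat" where
  "exc_pairs R = card {p \<in> R. fst p < snd p}"

definition fix_pairs :: "(nat \<times> nat) set \<Rightarrow> nat" where
  "fix_pairs R = card {p \<in> R. fst p = snd p}"

text \<open>\<open>P\<close> is shown only the graph on the numbers below \<open>k\<close>, the
  state of the history just before \<open>k\<close> is added, so no later step can change whether
  \<open>k\<close> is marked.\<close>

definition marked_peaks ::
    "((nat \<times> nat) set \<Rightarrow> nat \<Rightarrow> nat \<Rightarrow> nat \<Rightarrow> bool) \<Rightarrow> (nat \<times> nat) set \<Rightarrow> nat set" where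
  "marked_peaks P R = {k. \<exists>i\<in>{1..<k}. \<exists>v\<in>{1..<k}. (i, k) \<in> R \<and> (k, v) \<in> R \<and>
     P (R \<inter> {1..<k} \<times> {1..<k}) k i v}"

text \<open>A marking selects \<open>h\<close> of the \<open>h\<^sup>2\<close> ways of turning \<open>n + 1\<close> into a cycle peak; this is all that
  the recurrence uses of ear and pex.\<close>

definition marking :: "((nat \<times> nat) set \<Rightarrow> nat \<Rightarrow> nat \<Rightarrow> nat \<Rightarrow> bool) \<Rightarrow> bool" where
  "marking P \<longleftrightarrow> (\<forall>n. \<forall>R\<in>partial_perms n.
     card {(i, v) \<in> open_sources n R \<times> open_values n R. P R (Suc n) i v} = card (open_sources n R))"

text \<open>For a partial permutation, \<open>n - card R\<close> is the common number of open
  sources and open values, hence the argument \<open>h\<close>.\<close>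

definition stat_value :: "((nat \<times> nat) set \<Rightarrow> nat \<Rightarrow> nat \<Rightarrow> nat \<Rightarrow> bool) \<Rightarrow> nat \<Rightarrow>
    (int \<Rightarrow> int \<Rightarrow> int \<Rightarrow> int \<Rightarrow> int) \<Rightarrow> (nat \<times> nat) set \<Rightarrow> int" where
  "stat_value P n g R = g (int n - int (card R)) (int (exc_pairs R))
     (int (card (marked_peaks P R))) (int (fix_pairs R))"

lemma card_filter_Un:
  assumes "finite R" "finite D" "R \<inter> D = {}"
  shows "card {p \<in> R \<union> D. Q p} = card {p \<in> R. Q p} + card {p \<in> D. Q p}"
proof -
  have "{p \<in> R \<union> D. Q p} = {p \<in> R. Q p} \<union> {p \<in> D. Q p}" by auto
  then show ?thesis
    using assms by (simp add: card_Un_disjoint disjoint_iff)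
qed

lemma finite_extension: "D \<in> extensions n R \<Longrightarrow> finite D"
  by (auto simp: extensions_def)

lemma extension_disjoint:
  "R \<in> partial_perms n \<Longrightarrow> D \<in> extensions n R \<Longrightarrow> R \<inter> D = {}"
  using extension_outside partial_perms_subset by blast

lemma partial_perm_Un_extension_restrict:
  assumes "R \<in> partial_perms n" "D \<in> extensions n R"
  shows "(R \<union> D) \<inter> {1..n} \<times> {1..n} = R"
  using extension_outside[OF assms(2)] partial_perms_subset[OF assms(1)] by blast

lemma finite_marked_peaks:
  assumes "R \<in> partial_perms n" shows "finite (marked_peaks P R)"
proof (rule finite_subset)
  show "marked_peaks P R \<subseteq> {1..n}"
    using partial_permsD(1)[OF assms] by (auto simp: marked_peaks_def)
qed simp

lemma Suc_notin_marked_peaks: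
  assumes "R \<in> partial_perms n" shows "Suc n \<notin> marked_peaks P R"
  using partial_permsD(1)[OF assms] by (fastforce simp: marked_peaks_def)

text \<open>Membership of \<open>k\<close> depends only on the edges inside the box of side
  \<open>k\<close>. For \<open>k \<le> n\<close> these are untouched by \<open>D\<close>; for
  \<open>Suc n\<close> they are those of \<open>R\<close> and \<open>D\<close>; larger
  \<open>k\<close> carry no edges.\<close>

lemma marked_peaks_extension:
  assumes R: "R \<in> partial_perms n" and D: "D \<in> extensions n R"
  shows "marked_peaks P (R \<union> D) = marked_peaks P R \<union>
    {k. k = Suc n \<and> (\<exists>i\<in>{1..n}. \<exists>v\<in>{1..n}. (i, k) \<in> D \<and> (k, v) \<in> D \<and> P R k i v)}"
proof -
  have restrict: "(R \<union> D) \<inter> {1..n} \<times> {1..n} = R"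
    by (rule partial_perm_Un_extension_restrict[OF R D])
  have old: "k \<in> marked_peaks P (R \<union> D) \<longleftrightarrow> k \<in> marked_peaks P R" if k: "k \<le> n" for k
  proof -
    have "{1..<k} \<subseteq> {1..n}" using k by auto
    then have box: "(R \<union> D) \<inter> {1..<k} \<times> {1..<k} = R \<inter> {1..<k} \<times> {1..<k}"
      using restrict by blast
    have edges: "(i, k) \<in> R \<union> D \<longleftrightarrow> (i, k) \<in> R" "(k, i) \<in> R \<union> D \<longleftrightarrow> (k, i) \<in> R"
      if "i \<in> {1..<k}" for i
    proof -
      have "i \<in> {1..n}" "k \<in> {1..n}" using that k by auto
      then show "(i, k) \<in> R \<union> D \<longleftrightarrow> (i, k) \<in> R" "(k, i) \<in> R \<union> D \<longleftrightarrow> (k, i) \<in> R"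
        using restrict by blast+
    qed
    show ?thesis
      unfolding marked_peaks_def mem_Collect_eq box
      by (intro bex_cong refl) (simp only: edges)
  qed
  have "{1..<Suc n} = {1..n}" by auto
  moreover have "(Suc n, v) \<notin> R" "(v, Suc n) \<notin> R" for v
    using partial_permsD(1)[OF R, of "Suc n" v] partial_permsD(1)[OF R, of v "Suc n"] by auto
  ultimately have new: "Suc n \<in> marked_peaks P (R \<union> D) \<longleftrightarrow>
      (\<exists>i\<in>{1..n}. \<exists>v\<in>{1..n}. (i, Suc n) \<in> D \<and> (Suc n, v) \<in> D \<and> P R (Suc n) i v)"
    unfolding marked_peaks_def mem_Collect_eq using restrict by simp
  have large: "k \<notin> marked_peaks P S" if "k > Suc n" "S \<in> partial_perms (Suc n)" for k S
    using that partial_permsD(1)[OF that(2)] by (fastforce simp: marked_peaks_def)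
  \<comment> \<open>The empty extension shows \<open>R\<close> to be a partial permutation of [n+1],
    so that \<open>large\<close> covers it too.\<close>
  have RSuc: "R \<in> partial_perms (Suc n)"
    using extension_partial_perm[OF R, of "{}"] by (simp add: extensions_def)
  show ?thesis
  proof (rule set_eqI)
    fix k
    consider "k \<le> n" | "k = Suc n" | "k > Suc n" by linarith
    then show "k \<in> marked_peaks P (R \<union> D) \<longleftrightarrow> k \<in> marked_peaks P R \<union>
      {k. k = Suc n \<and> (\<exists>i\<in>{1..n}. \<exists>v\<in>{1..n}. (i, k) \<in> D \<and> (k, v) \<in> D \<and> P R k i v)}"
      using old new large[OF _ extension_partial_perm[OF R D]] large[OF _ RSuc]
        Suc_notin_marked_peaks[OF R]
      by cases auto
  qed
qed

text \<open>Sizes, excedances and fixed points add over the disjoint sets \<open>R\<close> and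
  \<open>D\<close>, and at most one new marked peak, \<open>Suc n\<close>, appears.\<close>

lemma stat_value_extension:
  assumes R: "R \<in> partial_perms n" and D: "D \<in> extensions n R"
  shows "stat_value P (Suc n) g (R \<union> D) =
    g (int n - int (card R) + 1 - int (card D)) (int (exc_pairs R) + int (exc_pairs D))
      (int (card (marked_peaks P R)) +
        (if \<exists>i\<in>{1..n}. \<exists>v\<in>{1..n}. (i, Suc n) \<in> D \<and> (Suc n, v) \<in> D \<and> P R (Suc n) i v then 1 else 0))
      (int (fix_pairs R) + int (fix_pairs D))"
proof -
  note fin = finite_partial_perm[OF R] finite_extension[OF D] and disj = extension_disjoint[OF R D]
  have "card (R \<union> D) = card R + card D"
    using fin disj by (simp add: card_Un_disjoint)
  moreover have "exc_pairs (R \<union> D) = exc_pairs R + exc_pairs D"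
    "fix_pairs (R \<union> D) = fix_pairs R + fix_pairs D"
    unfolding exc_pairs_def fix_pairs_def by (simp_all only: card_filter_Un[OF fin disj])
  moreover have "card (marked_peaks P (R \<union> D)) = card (marked_peaks P R) +
      (if \<exists>i\<in>{1..n}. \<exists>v\<in>{1..n}. (i, Suc n) \<in> D \<and> (Suc n, v) \<in> D \<and> P R (Suc n) i v then 1 else 0)"
    (is "_ = _ + (if ?A then 1 else 0)")
  proof (cases ?A)
    case True
    then have "marked_peaks P (R \<union> D) = insert (Suc n) (marked_peaks P R)"
      unfolding marked_peaks_extension[OF R D] by auto
    then show ?thesis
      using True finite_marked_peaks[OF R, of P] Suc_notin_marked_peaks[OF R, of P] by simp
  next
    case False
    then have "marked_peaks P (R \<union> D) = marked_peaks P R"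
      unfolding marked_peaks_extension[OF R D] by auto
    then show ?thesis using False by simp
  qed
  moreover have "int (Suc n) - int (card R + card D) = int n - int (card R) + 1 - int (card D)"
    by simp
  ultimately show ?thesis
    unfolding stat_value_def by (simp only: of_nat_add of_nat_1 of_nat_0 if_distrib[of int])
qed

lemma card_filter_insert:
  "finite R \<Longrightarrow> x \<notin> R \<Longrightarrow> card {p \<in> insert x R. Q p} = (if Q x then 1 else 0) + card {p \<in> R. Q p}"
proof -
  assume "finite R" "x \<notin> R"
  moreover have "{p \<in> insert x R. Q p} = (if Q x then {x} else {}) \<union> {p \<in> R. Q p}" by auto
  ultimately show ?thesis by simp
qed

lemma pairs_simps:
  "exc_pairs {} = 0" "fix_pairs {} = 0"
  "finite R \<Longrightarrow> (a, b) \<notin> R \<Longrightarrow> exc_pairs (insert (a, b) R) = (if a < b then 1 else 0) + exc_pairs R"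
  "finite R \<Longrightarrow> (a, b) \<notin> R \<Longrightarrow> fix_pairs (insert (a, b) R) = (if a = b then 1 else 0) + fix_pairs R"
  unfolding exc_pairs_def fix_pairs_def by (simp, simp) (subst card_filter_insert; simp)+

text \<open>The five kinds of extension yield the terms of \<open>history_step\<close>;
  \<open>marking P\<close> decides how the last kind is divided between \<open>q + 1\<close> and
  \<open>q\<close>.\<close>

lemma sum_stat_value_extensions:
  assumes P: "marking P" and R: "R \<in> partial_perms n"
  shows "(\<Sum>D\<in>extensions n R. stat_value P (Suc n) g (R \<union> D)) = stat_value P n (history_step g) R"
proof -
  let ?k = "Suc n" and ?O = "open_sources n R" and ?V = "open_values n R"
  define h where "h = int n - int (card R)"
  define e where "e = int (exc_pairs R)"
  define q where "q = int (card (marked_peaks P R))"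
  define f where "f = int (fix_pairs R)"
  \<comment> \<open>By \<open>stat_value_extension\<close>, \<open>S D\<close> is the value after
    adding \<open>D\<close>, expressed through the statistics of \<open>R\<close>, which stay fixed
    from here on.\<close>
  define S where "S D = g (h + 1 - int (card D)) (e + int (exc_pairs D))
      (q + (if \<exists>i\<in>{1..n}. \<exists>v\<in>{1..n}. (i, ?k) \<in> D \<and> (?k, v) \<in> D \<and> P R ?k i v then 1 else 0))
      (f + int (fix_pairs D))" for D
  have O: "i \<in> {1..n}" if "i \<in> ?O" for i using that by (simp add: open_sources_def)
  have V: "i \<in> {1..n}" if "i \<in> ?V" for i using that by (simp add: open_values_def)
  have fin: "finite (?O \<times> ?V)" by (simp add: open_sources_def open_values_def)
  have cO: "int (card ?O) = h" and cV: "int (card ?V) = h"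
    using card_open_sources[OF R] card_open_values[OF R] by (simp_all add: h_def)
  have S0: "S {} = g (h + 1) e q f"
    by (simp add: S_def pairs_simps)
  have S1: "S {(?k, ?k)} = g h e q (f + 1)"
    by (simp add: S_def pairs_simps)
  have S2: "S {(i, ?k)} = g h (e + 1) q f" if "i \<in> ?O" for i
    using O[OF that] by (simp add: S_def pairs_simps)
  have S3: "S {(?k, v)} = g h e q f" if "v \<in> ?V" for v
    using V[OF that] by (simp add: S_def pairs_simps)
  have S4: "S {(i, ?k), (?k, v)} =
      g (h - 1) (e + 1) (q + (if P R ?k i v then 1 else 0)) f" if "i \<in> ?O" "v \<in> ?V" for i v
  proof -
    have iv: "i \<in> {1..n}" "v \<in> {1..n}" "i \<noteq> ?k" "v \<noteq> ?k" using O[OF that(1)] V[OF that(2)] by auto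
    then have "(\<exists>i'\<in>{1..n}. \<exists>v'\<in>{1..n}. (i', ?k) \<in> {(i, ?k), (?k, v)} \<and>
        (?k, v') \<in> {(i, ?k), (?k, v)} \<and> P R ?k i' v') = P R ?k i v" by blast
    then show ?thesis
      using iv by (simp add: S_def pairs_simps)
  qed
  let ?M = "{(i, v) \<in> ?O \<times> ?V. P R ?k i v}"
  have "(\<Sum>(i, v)\<in>?O \<times> ?V. S {(i, ?k), (?k, v)}) =
      (\<Sum>p\<in>?O \<times> ?V. if p \<in> ?M then g (h - 1) (e + 1) (q + 1) f else g (h - 1) (e + 1) q f)"
    by (rule sum.cong) (auto simp: S4 split: if_split_asm)
  also have "\<dots> = (\<Sum>p\<in>?M. g (h - 1) (e + 1) (q + 1) f) + (\<Sum>p\<in>?O \<times> ?V - ?M. g (h - 1) (e + 1) q f)"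
  proof -
    have M: "(?O \<times> ?V) \<inter> {p. p \<in> ?M} = ?M" "(?O \<times> ?V) \<inter> - {p. p \<in> ?M} = ?O \<times> ?V - ?M" by auto
    show ?thesis
      unfolding sum.If_cases[OF fin, of "\<lambda>p. p \<in> ?M"] M ..
  qed
  \<comment> \<open>The marking picks \<open>h\<close> of the \<open>h * h\<close> pairs.\<close>
  also have "\<dots> = h * g (h - 1) (e + 1) (q + 1) f + (h * h - h) * g (h - 1) (e + 1) q f"
  proof -
    have sub: "?M \<subseteq> ?O \<times> ?V" by auto
    have "int (card ?M) = h" using P R cO unfolding marking_def by simp
    moreover from this have "int (card (?O \<times> ?V - ?M)) = h * h - h"
      using card_Diff_subset[OF finite_subset[OF sub fin] sub] card_mono[OF fin sub] cO cV
      by (simp add: of_nat_diff card_cartesian_product)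
    ultimately show ?thesis by (simp only: sum_constant of_nat_mult) 
  qed
  finally have peaks: "(\<Sum>(i, v)\<in>?O \<times> ?V. S {(i, ?k), (?k, v)}) =
    h * g (h - 1) (e + 1) (q + 1) f + h * (h - 1) * g (h - 1) (e + 1) q f"
    by (simp add: algebra_simps)
  have "(\<Sum>D\<in>extensions n R. stat_value P ?k g (R \<union> D)) = (\<Sum>D\<in>extensions n R. S D)"
    by (rule sum.cong) (simp_all add: stat_value_extension[OF R] S_def h_def e_def q_def f_def)
  also have "\<dots> = history_step g h e q f"
    unfolding sum_extensions peaks by (simp add: S0 S1 S2 S3 cO cV history_step_def)
  finally show ?thesis
    by (simp add: stat_value_def h_def e_def q_def f_def)
qed

section \<open>The two recurrences for histories\<close>

lemma sum_stat_value_Suc: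
  assumes "marking P"
  shows "sum (stat_value P (Suc n) g) (partial_perms (Suc n)) =
    sum (stat_value P n (history_step g)) (partial_perms n)"
  using sum_stat_value_extensions[OF assms] by (simp add: sum_partial_perms_Suc)

lemma partial_perms_0: "partial_perms 0 = {{}}"
  by (auto simp: partial_perms_def)

text \<open>One history step is split off, the induction hypothesis is applied to
  \<open>history_step g\<close>, and commutation lets the history step be absorbed again into a sum
  over the larger box.\<close>

lemma sum_stat_value_insertion:
  assumes "marking P"
  shows "sum (stat_value P (Suc n) g) (partial_perms (Suc n)) =
    sum (stat_value P n (insertion_step n g)) (partial_perms n)"
proof (induction n arbitrary: g)
  case 0
  \<comment> \<open>All arguments are 0 here, so the terms with a coefficient vanish and both
    operators leave \<open>g 1 0 0 0 + g 0 0 0 1\<close>.\<close>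
  show ?case
    unfolding sum_stat_value_Suc[OF assms]
    by (simp add: partial_perms_0 stat_value_def pairs_simps marked_peaks_def
        history_step_def insertion_step_def)
next
  case (Suc n)
  have "sum (stat_value P (Suc (Suc n)) g) (partial_perms (Suc (Suc n))) =
      sum (stat_value P n (insertion_step n (history_step g))) (partial_perms n)"
    unfolding sum_stat_value_Suc[OF assms, of "Suc n"] by (rule Suc.IH)
  also have "\<dots> = sum (stat_value P (Suc n) (insertion_step (Suc n) g)) (partial_perms (Suc n))"
    by (simp only: history_insertion_commute[symmetric] sum_stat_value_Suc[OF assms, of n])
  finally show ?case .
qed

subsection \<open>Inserting a new minimum into a word\<close>

text \<open>\<open>p\<close> is the number of letters in front of the new letter 1, hence ranges
  over \<open>{0..n}\<close>.\<close>

definition insert_min :: "nat \<Rightarrow> (nat \<Rightarrow> nat) \<Rightarrow> nat \<Rightarrow> nat \<Rightarrow> nat" where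
  "insert_min n \<sigma> p j = (if j = 0 \<or> j > Suc n then j else if j \<le> p then Suc (\<sigma> j)
     else if j = Suc p then 1 else Suc (\<sigma> (j - 1)))"

lemma Sym_image: "\<sigma> \<in> Sym n \<Longrightarrow> i \<in> {1..n} \<longleftrightarrow> \<sigma> i \<in> {1..n}"
  by (simp add: Sym_def permutes_in_image del: atLeastAtMost_iff)

lemma Sym_inj: "\<sigma> \<in> Sym n \<Longrightarrow> \<sigma> i = \<sigma> j \<longleftrightarrow> i = j"
  by (auto simp: Sym_def dest: permutes_inj inj_onD)

lemma Sym_outside: "\<sigma> \<in> Sym n \<Longrightarrow> i \<notin> {1..n} \<Longrightarrow> \<sigma> i = i"
  by (auto simp: Sym_def permutes_def)

lemma finite_Sym: "finite (Sym n)"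
  by (simp add: Sym_def finite_permutations)

lemma card_Sym: "card (Sym n) = fact n"
  by (simp add: Sym_def card_permutations)

text \<open>The position to which the letter at \<open>i\<close> moves when a new letter is put at
  \<open>Suc p\<close>.\<close>

definition skip :: "nat \<Rightarrow> nat \<Rightarrow> nat" where
  "skip p i = (if i \<le> p then i else Suc i)"

lemma inj_skip: "inj (skip p)"
  by (auto simp: inj_def skip_def split: if_splits)

lemma skip_cases: "j = Suc p \<or> (\<exists>i. j = skip p i)"
proof -
  have "j = skip p j \<or> j = Suc p \<or> j = skip p (j - 1)"
    by (auto simp: skip_def)
  then show ?thesis by blast
qed

lemma skip_neq: "skip p i \<noteq> Suc p"
  by (simp add: skip_def)

text \<open>Splits a claim about positions of the enlarged word into the new position, which must be
  excluded, and the positions of the old letters.\<close>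

lemma subset_eqI_skip:
  assumes "Suc p \<notin> A" "\<And>i. skip p i \<in> A \<longleftrightarrow> i \<in> B"
  shows "A = skip p ` B"
proof (rule set_eqI)
  fix j
  show "j \<in> A \<longleftrightarrow> j \<in> skip p ` B"
    using skip_cases[of j p]
  proof
    assume "j = Suc p"
    then show ?thesis using assms(1) skip_neq by (metis imageE)
  next
    assume "\<exists>i. j = skip p i"
    then show ?thesis using assms(2) inj_image_mem_iff[OF inj_skip] by blast
  qed
qed

lemma Sym_pos: "\<sigma> \<in> Sym n \<Longrightarrow> i \<in> {1..n} \<Longrightarrow> 0 < \<sigma> i"
  using Sym_image[of \<sigma> n i] by auto

lemma insert_min_skip: "p \<le> n \<Longrightarrow> i \<in> {1..n} \<Longrightarrow> insert_min n \<sigma> p (skip p i) = Suc (\<sigma> i)"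
  by (simp add: insert_min_def skip_def)

lemma insert_min_at: "p \<le> n \<Longrightarrow> insert_min n \<sigma> p (Suc p) = 1"
  by (simp add: insert_min_def)

lemma skip_range_cases:
  assumes "j \<in> {1..Suc n}" "p \<le> n"
  obtains "j = Suc p" | i where "i \<in> {1..n}" "j = skip p i"
proof (cases "j = Suc p")
  case False
  then obtain i where i: "j = skip p i" using skip_cases by blast
  then have "i \<in> {1..n}" using assms by (simp add: skip_def split: if_splits)
  then show thesis using i that(2) by blast
qed (use that in blast)

lemma insert_min_Sym:
  assumes \<sigma>: "\<sigma> \<in> Sym n" and p: "p \<le> n"
  shows "insert_min n \<sigma> p \<in> Sym (Suc n)"
proof -
  let ?\<tau> = "insert_min n \<sigma> p"
  note at = insert_min_at[OF p, of \<sigma>] and sk = insert_min_skip[OF p, of _ \<sigma>]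
  have "inj_on ?\<tau> {1..Suc n}"
  proof (rule inj_onI)
    fix i j assume i: "i \<in> {1..Suc n}" and j: "j \<in> {1..Suc n}" and eq: "?\<tau> i = ?\<tau> j"
    show "i = j"
    proof (rule skip_range_cases[OF i p]; rule skip_range_cases[OF j p])
      fix k l assume "k \<in> {1..n}" "i = skip p k" "l \<in> {1..n}" "j = skip p l"
      then show "i = j" using eq Sym_inj[OF \<sigma>] by (simp add: sk)
    next
      fix l assume "i = Suc p" "l \<in> {1..n}" "j = skip p l"
      then show "i = j" using eq Sym_pos[OF \<sigma>, of l] by (simp add: at sk)
    next
      fix l assume "j = Suc p" "l \<in> {1..n}" "i = skip p l"
      then show "i = j" using eq Sym_pos[OF \<sigma>, of l] by (simp add: at sk)
    qed simp
  qed
  moreover have "?\<tau> ` {1..Suc n} \<subseteq> {1..Suc n}"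
  proof
    fix y assume "y \<in> ?\<tau> ` {1..Suc n}"
    then obtain i where i: "i \<in> {1..Suc n}" and y: "y = ?\<tau> i" by blast
    from i p show "y \<in> {1..Suc n}"
    proof (rule skip_range_cases)
      fix k assume k: "k \<in> {1..n}" "i = skip p k"
      have "\<sigma> k \<in> {1..n}" using Sym_image[OF \<sigma>, of k] k by blast
      then show ?thesis using k by (simp add: y sk)
    qed (simp add: y at)
  qed
  ultimately have "bij_betw ?\<tau> {1..Suc n} {1..Suc n}"
    by (simp add: bij_betw_def endo_inj_surj)
  then show ?thesis
    unfolding Sym_def mem_Collect_eq
    by (rule bij_imp_permutes) (auto simp: insert_min_def)
qed

text \<open>\<open>p\<close> is recovered from the place of the letter 1, and the other letters then
  determine \<sigma>.\<close>

lemma inj_on_insert_min: "inj_on (\<lambda>(\<sigma>, p). insert_min n \<sigma> p) (Sym n \<times> {0..n})"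
proof (rule inj_onI, clarify)
  fix \<sigma> p \<sigma>' p'
  assume \<sigma>: "\<sigma> \<in> Sym n" and p: "p \<in> {0..n}" and \<sigma>': "\<sigma>' \<in> Sym n" and p': "p' \<in> {0..n}"
    and eq: "insert_min n \<sigma> p = insert_min n \<sigma>' p'"
  have p: "p \<le> n" and p': "p' \<le> n" using p p' by simp_all
  have "insert_min n \<sigma>' p' (Suc p) = insert_min n \<sigma>' p' (Suc p')"
    using insert_min_at[OF p, of \<sigma>] insert_min_at[OF p', of \<sigma>'] unfolding eq by simp
  then have pp: "p = p'"
    using Sym_inj[OF insert_min_Sym[OF \<sigma>' p']] by blast
  have "\<sigma> i = \<sigma>' i" for i
  proof (cases "i \<in> {1..n}")
    case True
    show ?thesis
      using insert_min_skip[OF p True, of \<sigma>] insert_min_skip[OF p' True, of \<sigma>'] eq pp by (metis nat.inject)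
  next
    case False
    then show ?thesis using Sym_outside[OF \<sigma>] Sym_outside[OF \<sigma>'] by simp
  qed
  then show "\<sigma> = \<sigma>' \<and> p = p'" using pp by auto
qed

lemma bij_betw_insert_min:
  "bij_betw (\<lambda>(\<sigma>, p). insert_min n \<sigma> p) (Sym n \<times> {0..n}) (Sym (Suc n))"
proof -
  let ?f = "\<lambda>(\<sigma>, p). insert_min n \<sigma> p"
  have "?f ` (Sym n \<times> {0..n}) \<subseteq> Sym (Suc n)"
    by (simp add: image_subset_iff insert_min_Sym)
  \<comment> \<open>Surjectivity by counting: n! (n + 1) = (n + 1)!.\<close>
  moreover have "card (?f ` (Sym n \<times> {0..n})) = card (Sym (Suc n))"
    unfolding card_image[OF inj_on_insert_min] card_cartesian_product card_Sym by simp
  ultimately have "?f ` (Sym n \<times> {0..n}) = Sym (Suc n)"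
    by (rule card_subset_eq[OF finite_Sym])
  with inj_on_insert_min show ?thesis
    by (rule bij_betw_imageI)
qed

section \<open>Descents, record descents and foremaxima under insertion\<close>

definition descents :: "nat \<Rightarrow> (nat \<Rightarrow> nat) \<Rightarrow> nat set" where
  "descents n \<sigma> = {i. descent n \<sigma> i}"

definition record_descents :: "nat \<Rightarrow> (nat \<Rightarrow> nat) \<Rightarrow> nat set" where
  "record_descents n \<sigma> = {i. descent n \<sigma> i \<and> is_record n \<sigma> i}"

definition foremaxima :: "nat \<Rightarrow> (nat \<Rightarrow> nat) \<Rightarrow> nat set" where
  "foremaxima n \<sigma> = {i. foremaximum n \<sigma> i}"

text \<open>A record exceeds its left neighbour, at position 1 by the convention \<sigma>(0) = 0;
  only the comparison on the right remains.\<close>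

lemma foremaxima_eq:
  assumes "\<sigma> \<in> Sym n"
  shows "foremaxima n \<sigma> = {i. is_record n \<sigma> i \<and> \<sigma> i < \<sigma> (i + 1)}"
proof -
  have prev: "\<sigma> (i - 1) < \<sigma> i" if i: "i \<in> {1..n}" and rec: "\<forall>j\<in>{1..<i}. \<sigma> j < \<sigma> i" for i
  proof (cases "i = 1")
    case True
    have "\<sigma> i \<in> {1..n}" using Sym_image[OF assms, of i] i by blast
    then show ?thesis using True Sym_outside[OF assms, of 0] by simp
  next
    case False
    then have "i - 1 \<in> {1..<i}" using i by auto
    then show ?thesis using rec by blast
  qed
  have "foremaximum n \<sigma> i \<longleftrightarrow> is_record n \<sigma> i \<and> \<sigma> i < \<sigma> (i + 1)" for i
  proof
    assume "is_record n \<sigma> i \<and> \<sigma> i < \<sigma> (i + 1)"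
    then show "foremaximum n \<sigma> i"
      using prev[of i] by (simp add: foremaximum_def double_ascent_def is_record_def)
  qed (simp add: foremaximum_def double_ascent_def)
  then show ?thesis by (simp add: foremaxima_def)
qed

context
  fixes n :: nat and \<sigma> :: "nat \<Rightarrow> nat" and p :: nat
  assumes \<sigma>: "\<sigma> \<in> Sym n" and p: "p \<le> n"
begin

text \<open>Raising all letters keeps their order, and a letter smaller than all others never
  prevents a record.\<close>

lemma is_record_insert_min_skip:
  "is_record (Suc n) (insert_min n \<sigma> p) (skip p i) \<longleftrightarrow> is_record n \<sigma> i"
proof (cases "i \<in> {1..n}")
  case i: True
  then have "skip p i \<in> {1..Suc n}" by (auto simp: skip_def)
  moreover have "(\<forall>j\<in>{1..<skip p i}. insert_min n \<sigma> p j < insert_min n \<sigma> p (skip p i)) \<longleftrightarrow>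
    (\<forall>j\<in>{1..<i}. \<sigma> j < \<sigma> i)" (is "?L \<longleftrightarrow> ?R")
  proof
    assume ?L
    show ?R
    proof
      fix j assume j: "j \<in> {1..<i}"
      then have "skip p j \<in> {1..<skip p i}" by (auto simp: skip_def)
      with \<open>?L\<close> have "insert_min n \<sigma> p (skip p j) < insert_min n \<sigma> p (skip p i)" by blast
      then show "\<sigma> j < \<sigma> i" using i j by (simp add: insert_min_skip[OF p])
    qed
  next
    assume ?R
    show ?L
    proof
      fix j assume j: "j \<in> {1..<skip p i}"
      from skip_cases[of j p] show "insert_min n \<sigma> p j < insert_min n \<sigma> p (skip p i)"
      proof
        assume "j = Suc p"
        then show ?thesis using Sym_pos[OF \<sigma> i] i by (simp add: insert_min_at[OF p] insert_min_skip[OF p])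
      next
        assume "\<exists>l. j = skip p l"
        then obtain l where l: "j = skip p l" by blast
        then have "l \<in> {1..<i}" using j by (auto simp: skip_def split: if_splits)
        then show ?thesis using \<open>?R\<close> i l by (simp add: insert_min_skip[OF p])
      qed
    qed
  qed
  ultimately show ?thesis using i by (simp add: is_record_def)
next
  case False
  then show ?thesis using p by (auto simp: is_record_def skip_def split: if_splits)
qed

lemma insert_min_next:
  assumes i: "i \<in> {1..n}"
  shows "insert_min n \<sigma> p (skip p i + 1) = (if i = p then 1 else Suc (\<sigma> (i + 1)))"
proof (cases "i = n")
  case True
  \<comment> \<open>Unless the new letter follows it, the last letter is succeeded by the
    conventional value n + 2, which is \<open>Suc (\<sigma> (n + 1))\<close>.\<close>
  then show ?thesis using i p Sym_outside[OF \<sigma>, of "Suc n"] by (auto simp: insert_min_def skip_def)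
next
  case False
  then have "i \<noteq> p \<Longrightarrow> skip p i + 1 = skip p (i + 1)" by (auto simp: skip_def)
  then show ?thesis
    using False i insert_min_at[OF p] insert_min_skip[OF p, of "i + 1"] by (auto simp: skip_def)
qed

text \<open>Only the letter in front of the new minimum is compared with a different successor, and
  it becomes a descent.\<close>

lemma descent_insert_min_skip:
  "descent (Suc n) (insert_min n \<sigma> p) (skip p i) \<longleftrightarrow> i \<in> {1..n} \<and> (i = p \<or> descent n \<sigma> i)"
proof (cases "i \<in> {1..n}")
  case True
  have "\<sigma> n \<le> n" using Sym_image[OF \<sigma>, of n] True by auto
  have "skip p i \<in> {1..<Suc n} \<longleftrightarrow> i = p \<or> i < n \<or> i \<le> p"
    using True p by (auto simp: skip_def)
  \<comment> \<open>By \<sigma>(n + 1) = n + 1 there is no drop after the last letter, which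
    reconciles the ranges \<open>{1..<n}\<close> and \<open>{1..<Suc n}\<close>.\<close>
  moreover have "i = n \<Longrightarrow> \<not> \<sigma> i > \<sigma> (i + 1)"
    using \<open>\<sigma> n \<le> n\<close> Sym_outside[OF \<sigma>, of "Suc n"] by simp
  ultimately show ?thesis
    using True p Sym_pos[OF \<sigma> True] unfolding descent_def insert_min_next[OF True] insert_min_skip[OF p True]
    by (auto simp: le_less)
next
  case False
  then show ?thesis using p by (auto simp: descent_def skip_def split: if_splits)
qed

lemma not_descent_insert_min: "\<not> descent (Suc n) (insert_min n \<sigma> p) (Suc p)"
proof
  assume d: "descent (Suc n) (insert_min n \<sigma> p) (Suc p)"
  then have "Suc (Suc p) \<in> {1..Suc n}" by (simp add: descent_def)
  then have "insert_min n \<sigma> p (Suc (Suc p)) \<in> {1..Suc n}"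
    using Sym_image[OF insert_min_Sym[OF \<sigma> p]] by blast
  then show False using d by (simp add: descent_def insert_min_at[OF p])
qed

lemma descents_insert_min:
  "descents (Suc n) (insert_min n \<sigma> p) = skip p ` (descents n \<sigma> \<union> ({p} - {0}))"
proof (rule subset_eqI_skip)
  fix i
  show "skip p i \<in> descents (Suc n) (insert_min n \<sigma> p) \<longleftrightarrow> i \<in> descents n \<sigma> \<union> ({p} - {0})"
    using p by (auto simp: descents_def descent_insert_min_skip) (auto simp: descent_def)
qed (simp add: descents_def not_descent_insert_min)

lemma record_descents_insert_min:
  "record_descents (Suc n) (insert_min n \<sigma> p) =
    skip p ` (record_descents n \<sigma> \<union> {i. i = p \<and> is_record n \<sigma> i})"
proof (rule subset_eqI_skip)
  fix i
  have "is_record n \<sigma> i \<Longrightarrow> i \<in> {1..n}" by (simp add: is_record_def)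
  then show "skip p i \<in> record_descents (Suc n) (insert_min n \<sigma> p) \<longleftrightarrow>
      i \<in> record_descents n \<sigma> \<union> {i. i = p \<and> is_record n \<sigma> i}"
    unfolding record_descents_def mem_Collect_eq Un_iff descent_insert_min_skip
      is_record_insert_min_skip by blast
qed (simp add: record_descents_def not_descent_insert_min)

text \<open>The new minimum is a record only in front, where a larger letter follows. Elsewhere it
  puts a drop after the letter at \<open>p\<close>, which removes \<open>p\<close> from the
  foremaxima.\<close>

lemma foremaxima_insert_min:
  "foremaxima (Suc n) (insert_min n \<sigma> p) =
    (if p = 0 then {1} else {}) \<union> skip p ` (foremaxima n \<sigma> - {p})"
proof -
  let ?\<tau> = "insert_min n \<sigma> p"
  have \<tau>: "?\<tau> \<in> Sym (Suc n)" by (rule insert_min_Sym[OF \<sigma> p])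
  have *: "skip p i \<in> foremaxima (Suc n) ?\<tau> \<longleftrightarrow> i \<in> foremaxima n \<sigma> - {p}" for i
  proof (cases "is_record n \<sigma> i")
    case True
    then have i: "i \<in> {1..n}" by (simp add: is_record_def)
    show ?thesis
      using True Sym_pos[OF \<sigma> i]
      unfolding foremaxima_eq[OF \<sigma>] foremaxima_eq[OF \<tau>] mem_Collect_eq Diff_iff
        is_record_insert_min_skip insert_min_next[OF i] insert_min_skip[OF p i]
      by simp
  next
    case False
    then show ?thesis
      unfolding foremaxima_eq[OF \<sigma>] foremaxima_eq[OF \<tau>] by (simp add: is_record_insert_min_skip)
  qed
  have "Suc p \<in> foremaxima (Suc n) ?\<tau> \<longleftrightarrow> p = 0"
  proof
    assume "p = 0"
    have "?\<tau> 1 < ?\<tau> (1 + 1)"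
    \<comment> \<open>In the one-letter word the successor of the new letter is the conventional
      value 2.\<close>
    proof (cases "n = 0")
      case True
      then show ?thesis using \<open>p = 0\<close> by (simp add: insert_min_def)
    next
      case False
      then show ?thesis using \<open>p = 0\<close> Sym_pos[OF \<sigma>, of 1] by (simp add: insert_min_def)
    qed
    then show "Suc p \<in> foremaxima (Suc n) ?\<tau>" 
      unfolding foremaxima_eq[OF \<tau>] is_record_def using \<open>p = 0\<close> by simp
  next
    assume "Suc p \<in> foremaxima (Suc n) ?\<tau>"
    then have rec: "\<forall>j\<in>{1..<Suc p}. ?\<tau> j < ?\<tau> (Suc p)"
      unfolding foremaxima_eq[OF \<tau>] is_record_def by blast
    show "p = 0"
    proof (rule ccontr)
      assume "p \<noteq> 0"
      then have "?\<tau> p < 1" using rec by (simp add: insert_min_at[OF p])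
      moreover have "?\<tau> p \<in> {1..Suc n}" using Sym_image[OF \<tau>, of p] \<open>p \<noteq> 0\<close> p by simp
      ultimately show False by simp
    qed
  qed
  then have "foremaxima (Suc n) ?\<tau> - (if p = 0 then {1} else {}) = skip p ` (foremaxima n \<sigma> - {p})"
    by (intro subset_eqI_skip) (use * skip_neq[of p] in auto)
  moreover have "(if p = 0 then {1} else {}) \<subseteq> foremaxima (Suc n) ?\<tau>"
    using \<open>Suc p \<in> foremaxima (Suc n) ?\<tau> \<longleftrightarrow> p = 0\<close> by (cases "p = 0") simp_all
  ultimately show ?thesis by blast
qed

end

lemma descents_subset: "descents n \<sigma> \<subseteq> {1..n}"
  by (auto simp: descents_def descent_def)

lemma record_descents_subset: "record_descents n \<sigma> \<subseteq> descents n \<sigma>"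
  by (auto simp: descents_def record_descents_def)

lemma foremaxima_subset: "foremaxima n \<sigma> \<subseteq> {1..n}"
  by (auto simp: foremaxima_def foremaximum_def double_ascent_def)

lemma descents_foremaxima_disjoint: "descents n \<sigma> \<inter> foremaxima n \<sigma> = {}"
  by (auto simp: descents_def foremaxima_def descent_def foremaximum_def double_ascent_def)

text \<open>A record followed by a smaller letter is a record descent, one followed by a larger
  letter a foremaximum. The last position falls under the second case since \<sigma>(n + 1) = n +
  1.\<close>

lemma is_record_cases:
  assumes \<sigma>: "\<sigma> \<in> Sym n" and "is_record n \<sigma> i"
  shows "i \<in> record_descents n \<sigma> \<or> i \<in> foremaxima n \<sigma>"
proof -
  have i: "i \<in> {1..n}" using assms(2) by (simp add: is_record_def)
  have "\<sigma> (i + 1) \<noteq> \<sigma> i" using Sym_inj[OF \<sigma>] by simp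
  moreover have "i < n" if "\<sigma> (i + 1) < \<sigma> i"
  proof (rule ccontr)
    assume "\<not> i < n"
    then have "i = n" using i by simp
    moreover have "\<sigma> i \<in> {1..n}" using Sym_image[OF \<sigma>, of i] i by blast
    ultimately show False using that Sym_outside[OF \<sigma>, of "i + 1"] by simp
  qed
  ultimately show ?thesis
    using assms(2) i unfolding foremaxima_eq[OF \<sigma>] record_descents_def descent_def mem_Collect_eq
    by (metis atLeastAtMost_iff atLeastLessThan_iff nat_neq_iff)
qed

lemma card_skip_image: "card (skip p ` A) = card A"
  by (rule card_image) (rule inj_on_subset[OF inj_skip], simp)

text \<open>There are four classes of \<open>p\<close>: in front (\<open>f\<close> grows), after a
  descent (nothing changes), after a foremaximum (which turns into a record descent), and after one
  of the remaining n - e - f letters, which are ascents but no records (only \<open>e\<close>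
  grows).\<close>

lemma sum_insert_min:
  fixes g :: "nat \<Rightarrow> nat \<Rightarrow> nat \<Rightarrow> int"
  assumes \<sigma>: "\<sigma> \<in> Sym n"
  defines "e \<equiv> card (descents n \<sigma>)" and "q \<equiv> card (record_descents n \<sigma>)"
    and "f \<equiv> card (foremaxima n \<sigma>)"
  shows "(\<Sum>p = 0..n. g (card (descents (Suc n) (insert_min n \<sigma> p)))
      (card (record_descents (Suc n) (insert_min n \<sigma> p)))
      (card (foremaxima (Suc n) (insert_min n \<sigma> p)))) =
    g e q (f + 1) + int e * g e q f + int f * g (e + 1) (q + 1) (f - 1)
      + (int n - int e - int f) * g (e + 1) q f"
proof -
  let ?D = "descents n \<sigma>" and ?Q = "record_descents n \<sigma>" and ?F = "foremaxima n \<sigma>"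
  define G where "G p = g (card (descents (Suc n) (insert_min n \<sigma> p)))
      (card (record_descents (Suc n) (insert_min n \<sigma> p)))
      (card (foremaxima (Suc n) (insert_min n \<sigma> p)))" for p
  have finD: "finite ?D" and finF: "finite ?F"
    by (rule finite_subset[OF descents_subset finite_atLeastAtMost],
        rule finite_subset[OF foremaxima_subset finite_atLeastAtMost])
  have finQ: "finite ?Q" by (rule finite_subset[OF record_descents_subset finD])
  have G0: "G 0 = g e q (f + 1)"
  proof -
    have "?Q \<union> {i. i = 0 \<and> is_record n \<sigma> i} = ?Q" by (auto simp: is_record_def)
    moreover have "?F - {0} = ?F" using foremaxima_subset[of n \<sigma>] by auto
    moreover have "1 \<notin> skip 0 ` ?F" using skip_neq[of 0] by (metis One_nat_def imageE)
    ultimately show ?thesis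
      unfolding G_def descents_insert_min[OF \<sigma> le0] record_descents_insert_min[OF \<sigma> le0]
        foremaxima_insert_min[OF \<sigma> le0]
      using finF by (simp add: card_skip_image e_def q_def f_def)
  qed
  have GD: "G p = g e q f" if p: "p \<in> ?D" for p
  proof -
    have pn: "p \<le> n" "p \<noteq> 0" using p descents_subset[of n \<sigma>] by auto
    have pF: "p \<notin> ?F" using p descents_foremaxima_disjoint[of n \<sigma>] by auto
    have "?D \<union> ({p} - {0}) = ?D" using p by auto
    \<comment> \<open>If the descent \<open>p\<close> is a record, it is no foremaximum and hence
      already in \<open>?Q\<close>.\<close>
    moreover have "?Q \<union> {i. i = p \<and> is_record n \<sigma> i} = ?Q"
      using is_record_cases[OF \<sigma>, of p] pF by auto
    moreover have "?F - {p} = ?F" using pF by simp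
    ultimately show ?thesis
      unfolding G_def descents_insert_min[OF \<sigma> pn(1)] record_descents_insert_min[OF \<sigma> pn(1)]
        foremaxima_insert_min[OF \<sigma> pn(1)]
      using pn(2) by (simp add: card_skip_image e_def q_def f_def)
  qed
  have GF: "G p = g (e + 1) (q + 1) (f - 1)" if p: "p \<in> ?F" for p
  proof -
    have pn: "p \<le> n" "p \<noteq> 0" using p foremaxima_subset[of n \<sigma>] by auto
    have pD: "p \<notin> ?D" using p descents_foremaxima_disjoint[of n \<sigma>] by auto
    then have pQ: "p \<notin> ?Q" using record_descents_subset by blast
    have "?D \<union> ({p} - {0}) = insert p ?D" using pn by auto
    moreover have "?Q \<union> {i. i = p \<and> is_record n \<sigma> i} = insert p ?Q"
      using p by (auto simp: foremaxima_def foremaximum_def)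
    ultimately show ?thesis
      unfolding G_def descents_insert_min[OF \<sigma> pn(1)] record_descents_insert_min[OF \<sigma> pn(1)]
        foremaxima_insert_min[OF \<sigma> pn(1)]
      using pn(2) pD pQ p finD finQ finF by (simp add: card_skip_image e_def q_def f_def del: image_insert)
  qed
  have GR: "G p = g (e + 1) q f" if p: "p \<in> {1..n} - (?D \<union> ?F)" for p
  proof -
    have pn: "p \<le> n" "p \<noteq> 0" using p by auto
    have "?D \<union> ({p} - {0}) = insert p ?D" using pn by auto
    moreover have "?Q \<union> {i. i = p \<and> is_record n \<sigma> i} = ?Q"
      using is_record_cases[OF \<sigma>, of p] p by auto
    moreover have "?F - {p} = ?F" using p by simp
    ultimately show ?thesis
      unfolding G_def descents_insert_min[OF \<sigma> pn(1)] record_descents_insert_min[OF \<sigma> pn(1)]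
        foremaxima_insert_min[OF \<sigma> pn(1)]
      using pn(2) p finD by (simp add: card_skip_image e_def q_def f_def del: image_insert)
  qed
  have sub: "?D \<union> ?F \<subseteq> {1..n}" using descents_subset foremaxima_subset by blast
  have cU: "card (?D \<union> ?F) = e + f"
    using card_Un_disjoint[OF finD finF descents_foremaxima_disjoint] by (simp add: e_def f_def)
  have "e + f \<le> n" using card_mono[OF _ sub] cU by simp
  then have cR: "int (card ({1..n} - (?D \<union> ?F))) = int n - int e - int f"
    using card_Diff_subset[OF _ sub] finD finF cU by (simp add: of_nat_diff)
  have "(\<Sum>p = 0..n. G p) = G 0 + (\<Sum>p = 1..n. G p)"
    by (simp add: sum.atLeast_Suc_atMost)
  also have "(\<Sum>p = 1..n. G p) = (\<Sum>p\<in>{1..n} - (?D \<union> ?F). G p) + (\<Sum>p\<in>?D \<union> ?F. G p)"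
    by (rule sum.subset_diff[OF sub]) simp
  also have "(\<Sum>p\<in>?D \<union> ?F. G p) = (\<Sum>p\<in>?D. G p) + (\<Sum>p\<in>?F. G p)"
    by (rule sum.union_disjoint[OF finD finF descents_foremaxima_disjoint])
  also have "(\<Sum>p\<in>?D. G p) = int e * g e q f" using GD by (simp add: e_def)
  also have "(\<Sum>p\<in>?F. G p) = int f * g (e + 1) (q + 1) (f - 1)" using GF by (simp add: f_def)
  also have "(\<Sum>p\<in>{1..n} - (?D \<union> ?F). G p) = (int n - int e - int f) * g (e + 1) q f"
    using GR cR by simp
  finally have "(\<Sum>p = 0..n. G p) = g e q (f + 1) + int e * g e q f
      + int f * g (e + 1) (q + 1) (f - 1) + (int n - int e - int f) * g (e + 1) q f"
    unfolding G0 by simp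
  then show ?thesis unfolding G_def .
qed

section \<open>The recurrence for words\<close>

definition word_value :: "nat \<Rightarrow> (int \<Rightarrow> int \<Rightarrow> int \<Rightarrow> int) \<Rightarrow> (nat \<Rightarrow> nat) \<Rightarrow> int" where
  "word_value n g \<sigma> = g (int (des n \<sigma>)) (int (des2 n \<sigma>)) (int (fmax n \<sigma>))"

lemma word_value_eq:
  "word_value n g \<sigma> = g (int (card (descents n \<sigma>))) (int (card (record_descents n \<sigma>)))
    (int (card (foremaxima n \<sigma>)))"
proof -
  have "{i. descent n \<sigma> i \<and> (\<forall>j\<in>{1..<i}. \<sigma> j < \<sigma> i)} = record_descents n \<sigma>"
    unfolding record_descents_def is_record_def descent_def by fastforce
  then show ?thesis
    by (simp add: word_value_def des_def des2_def fmax_def descents_def foremaxima_def)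
qed

lemma sum_word_value_Suc:
  "sum (word_value (Suc n) g) (Sym (Suc n)) =
    sum (word_value n (\<lambda>e q f. g e q (f + 1) + e * g e q f + f * g (e + 1) (q + 1) (f - 1)
      + (int n - e - f) * g (e + 1) q f)) (Sym n)"
proof -
  have "sum (word_value (Suc n) g) (Sym (Suc n)) =
      (\<Sum>(\<sigma>, p)\<in>Sym n \<times> {0..n}. word_value (Suc n) g (insert_min n \<sigma> p))"
    unfolding sum.reindex_bij_betw[OF bij_betw_insert_min, symmetric] by (simp add: case_prod_beta)
  also have "\<dots> = (\<Sum>\<sigma>\<in>Sym n. \<Sum>p = 0..n. word_value (Suc n) g (insert_min n \<sigma> p))"
    by (rule sum.cartesian_product[symmetric])
  also have "\<dots> = sum (word_value n (\<lambda>e q f. g e q (f + 1) + e * g e q f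
      + f * g (e + 1) (q + 1) (f - 1) + (int n - e - f) * g (e + 1) q f)) (Sym n)"
  proof (rule sum.cong[OF refl])
    fix \<sigma> assume \<sigma>: "\<sigma> \<in> Sym n"
    show "(\<Sum>p = 0..n. word_value (Suc n) g (insert_min n \<sigma> p)) =
      word_value n (\<lambda>e q f. g e q (f + 1) + e * g e q f
        + f * g (e + 1) (q + 1) (f - 1) + (int n - e - f) * g (e + 1) q f) \<sigma>"
    \<comment> \<open>In \<open>sum_insert_min\<close> the difference \<open>f - 1\<close> is
      truncated, in the claim it is an integer; at \<open>f = 0\<close> the coefficient
      \<open>f\<close> kills the term.\<close>
    proof (cases "card (foremaxima n \<sigma>)")
      case 0
      then show ?thesis
        unfolding word_value_eq sum_insert_min[OF \<sigma>, of "\<lambda>e q f. g (int e) (int q) (int f)"]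
        by (simp add: add.commute)
    next
      case (Suc f)
      then show ?thesis
        unfolding word_value_eq sum_insert_min[OF \<sigma>, of "\<lambda>e q f. g (int e) (int q) (int f)"]
        by (simp add: add.commute)
    qed
  qed
  finally show ?thesis .
qed

subsection \<open>Permutation graphs\<close>

text \<open>For an open value \<open>v\<close> the condition makes \<open>v\<close> the least open
  one. At a cycle peak \<open>k\<close> of a permutation, with \<open>v = \<sigma> k\<close>, it
  says that all smaller values occur before position \<open>k\<close>: an antirecord.\<close>

definition min_value_mark :: "(nat \<times> nat) set \<Rightarrow> nat \<Rightarrow> nat \<Rightarrow> nat \<Rightarrow> bool" where
  "min_value_mark S k i v \<longleftrightarrow> {1..<v} \<subseteq> Range S"

text \<open>For an open source \<open>i\<close> below \<open>k\<close> the condition makes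
  \<open>i\<close> the largest open one. Reflected in the antidiagonal it becomes the condition of
  \<open>pex\<close>.\<close>

definition max_source_mark :: "(nat \<times> nat) set \<Rightarrow> nat \<Rightarrow> nat \<Rightarrow> nat \<Rightarrow> bool" where
  "max_source_mark S k i v \<longleftrightarrow> {i<..<k} \<subseteq> Domain S"

lemma card_open_eq:
  assumes "R \<in> partial_perms n" shows "card (open_sources n R) = card (open_values n R)"
  using card_open_sources[OF assms] card_open_values[OF assms] by simp

text \<open>\<open>v\<close> must be the least open value while \<open>i\<close> is free.\<close>

lemma marking_min_value: "marking min_value_mark"
  unfolding marking_def
proof (intro allI ballI)
  fix n R assume R: "R \<in> partial_perms n"
  let ?O = "open_sources n R" and ?V = "open_values n R"
  have fin: "finite ?V" by (simp add: open_values_def)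
  show "card {(i, v) \<in> ?O \<times> ?V. min_value_mark R (Suc n) i v} = card ?O"
  proof (cases "?V = {}")
    case True
    then show ?thesis using card_open_eq[OF R] by simp
  next
    case False
    have "min_value_mark R (Suc n) i v \<longleftrightarrow> v = Min ?V" if v: "v \<in> ?V" for i v
    proof
      assume m: "min_value_mark R (Suc n) i v"
      have "v \<le> w" if "w \<in> ?V" for w
      proof (rule ccontr)
        assume "\<not> v \<le> w"
        then have "w \<in> {1..<v}" using that by (simp add: open_values_def)
        then have "w \<in> Range R" using m unfolding min_value_mark_def by blast
        then show False using that by (simp add: open_values_def)
      qed
      then show "v = Min ?V" using v by (intro Min_eqI[OF fin, symmetric])
    next
      assume "v = Min ?V"
      then have min: "v \<le> w" if "w \<in> ?V" for w using that fin by simp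
      show "min_value_mark R (Suc n) i v"
        unfolding min_value_mark_def
      proof
        fix w assume w: "w \<in> {1..<v}"
        then have "w \<notin> ?V" using min[of w] by auto
        then show "w \<in> Range R" using w v by (simp add: open_values_def)
      qed
    qed
    then have "{(i, v) \<in> ?O \<times> ?V. min_value_mark R (Suc n) i v} = ?O \<times> {Min ?V}"
      using Min_in[OF fin False] by auto
    then show ?thesis by (simp add: card_cartesian_product)
  qed
qed

text \<open>\<open>i\<close> must be the largest open source while \<open>v\<close> is free, and
  there are as many open values as open sources.\<close>

lemma marking_max_source: "marking max_source_mark"
  unfolding marking_def
proof (intro allI ballI)
  fix n R assume R: "R \<in> partial_perms n"
  let ?O = "open_sources n R" and ?V = "open_values n R"
  have fin: "finite ?O" by (simp add: open_sources_def)
  show "card {(i, v) \<in> ?O \<times> ?V. max_source_mark R (Suc n) i v} = card ?O"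
  proof (cases "?O = {}")
    case True
    then show ?thesis by simp
  next
    case False
    have "max_source_mark R (Suc n) i v \<longleftrightarrow> i = Max ?O" if i: "i \<in> ?O" for i v
    proof
      assume m: "max_source_mark R (Suc n) i v"
      have "w \<le> i" if "w \<in> ?O" for w
      proof (rule ccontr)
        assume "\<not> w \<le> i"
        then have "w \<in> {i<..<Suc n}" using that by (simp add: open_sources_def)
        then have "w \<in> Domain R" using m unfolding max_source_mark_def by blast
        then show False using that by (simp add: open_sources_def)
      qed
      then show "i = Max ?O" using i by (intro Max_eqI[OF fin, symmetric])
    next
      assume "i = Max ?O"
      then have max: "w \<le> i" if "w \<in> ?O" for w using that fin by simp
      show "max_source_mark R (Suc n) i v"
        unfolding max_source_mark_def
      proof
        fix w assume w: "w \<in> {i<..<Suc n}"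
        then have "w \<notin> ?O" using max[of w] by auto
        then show "w \<in> Domain R" using w i by (simp add: open_sources_def)
      qed
    qed
    then have "{(i, v) \<in> ?O \<times> ?V. max_source_mark R (Suc n) i v} = {Max ?O} \<times> ?V"
      using Max_in[OF fin False] by auto
    then show ?thesis using card_open_eq[OF R] by (simp add: card_cartesian_product)
  qed
qed

section \<open>Histories without open positions at the end\<close>

definition complete_only :: "(int \<Rightarrow> int \<Rightarrow> int \<Rightarrow> int) \<Rightarrow> int \<Rightarrow> int \<Rightarrow> int \<Rightarrow> int \<Rightarrow> int" where
  "complete_only g h e q f = (if h = 0 then g e q f else 0)"

text \<open>The term at \<open>h + 1\<close> disappears, because \<open>h \<ge> 0\<close> makes
  \<open>h + 1\<close> nonzero; at \<open>h = 0\<close> the coefficient \<open>h + e\<close> is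
  \<open>e\<close>, and the recurrence for words remains.\<close>

lemma insertion_step_complete_only:
  "h \<ge> 0 \<Longrightarrow> insertion_step n (complete_only g) h e q f =
    complete_only (\<lambda>e q f. g e q (f + 1) + e * g e q f + f * g (e + 1) (q + 1) (f - 1)
      + (int n - e - f) * g (e + 1) q f) h e q f"
  by (simp add: insertion_step_def complete_only_def)

lemma card_partial_perm_le:
  assumes "R \<in> partial_perms n" shows "card R \<le> n"
  using card_open_sources[OF assms] by simp

text \<open>Both sides obey the insertion recurrence and start with the same value at
  \<open>n = 0\<close>.\<close>

lemma sum_complete_only_eq_sum_word_value:
  assumes P: "marking P"
  shows "sum (stat_value P n (complete_only g)) (partial_perms n) = sum (word_value n g) (Sym n)"
proof (induction n arbitrary: g)
  case 0
  have "Sym 0 = {\<lambda>i. i}" by (auto simp: Sym_def id_def)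
  moreover have "word_value 0 g (\<lambda>i. i) = g 0 0 0"
    by (simp add: word_value_def des_def des2_def fmax_def descent_def foremaximum_def double_ascent_def)
  ultimately show ?case
    by (simp add: partial_perms_0 stat_value_def pairs_simps marked_peaks_def complete_only_def)
next
  case (Suc n)
  have "sum (stat_value P (Suc n) (complete_only g)) (partial_perms (Suc n)) =
      sum (stat_value P n (insertion_step n (complete_only g))) (partial_perms n)"
    by (rule sum_stat_value_insertion[OF P])
  also have "\<dots> = sum (stat_value P n (complete_only (\<lambda>e q f. g e q (f + 1) + e * g e q f
      + f * g (e + 1) (q + 1) (f - 1) + (int n - e - f) * g (e + 1) q f))) (partial_perms n)"
    by (rule sum.cong[OF refl], unfold stat_value_def, rule insertion_step_complete_only)
      (simp add: card_partial_perm_le)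
  also have "\<dots> = sum (word_value (Suc n) g) (Sym (Suc n))"
    unfolding Suc.IH sum_word_value_Suc ..
  finally show ?case .
qed

section \<open>Permutations as partial permutations with n edges\<close>

definition perm_graph :: "nat \<Rightarrow> (nat \<Rightarrow> nat) \<Rightarrow> (nat \<times> nat) set" where
  "perm_graph n \<sigma> = (\<lambda>i. (i, \<sigma> i)) ` {1..n}"

lemma in_perm_graph_iff: "(i, v) \<in> perm_graph n \<sigma> \<longleftrightarrow> i \<in> {1..n} \<and> v = \<sigma> i"
  by (auto simp: perm_graph_def)

lemma card_perm_graph: "card (perm_graph n \<sigma>) = n"
  unfolding perm_graph_def by (subst card_image) (auto simp: inj_on_def)

lemma perm_graph_partial_perm:
  assumes \<sigma>: "\<sigma> \<in> Sym n" shows "perm_graph n \<sigma> \<in> partial_perms n"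
proof (rule partial_permsI)
  fix a b c d
  show "a \<in> {1..n} \<and> b \<in> {1..n}" if "(a, b) \<in> perm_graph n \<sigma>"
    using that Sym_image[OF \<sigma>, of a] unfolding in_perm_graph_iff by blast
  show "a = c \<longleftrightarrow> b = d" if "(a, b) \<in> perm_graph n \<sigma>" "(c, d) \<in> perm_graph n \<sigma>"
    using that Sym_inj[OF \<sigma>] unfolding in_perm_graph_iff by blast
qed

text \<open>\<open>n\<close> edges in the box of side \<open>n\<close> use up every source, so the
  relation is a total injective function.\<close>

lemma bij_betw_perm_graph: "bij_betw (perm_graph n) (Sym n) {R \<in> partial_perms n. card R = n}"
proof (rule bij_betw_imageI)
  show "inj_on (perm_graph n) (Sym n)"
  proof (rule inj_onI)
    fix \<sigma> \<tau> assume \<sigma>: "\<sigma> \<in> Sym n" and \<tau>: "\<tau> \<in> Sym n" and eq: "perm_graph n \<sigma> = perm_graph n \<tau>"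
    show "\<sigma> = \<tau>"
    proof
      fix i show "\<sigma> i = \<tau> i"
      proof (cases "i \<in> {1..n}")
        case True
        then have "(i, \<sigma> i) \<in> perm_graph n \<tau>" unfolding eq[symmetric] in_perm_graph_iff by blast
        then show ?thesis unfolding in_perm_graph_iff by blast
      next
        case False
        then show ?thesis using Sym_outside[OF \<sigma>] Sym_outside[OF \<tau>] by simp
      qed
    qed
  qed
  show "perm_graph n ` Sym n = {R \<in> partial_perms n. card R = n}"
  proof
    show "perm_graph n ` Sym n \<subseteq> {R \<in> partial_perms n. card R = n}"
      using perm_graph_partial_perm card_perm_graph by blast
    show "{R \<in> partial_perms n. card R = n} \<subseteq> perm_graph n ` Sym n"
    proof
      fix R assume "R \<in> {R \<in> partial_perms n. card R = n}"
      then have R: "R \<in> partial_perms n" and n: "card R = n" by simp_all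
      have "Domain R \<subseteq> {1..n}" using partial_perms_subset[OF R] by blast
      then have dom: "Domain R = {1..n}"
        using card_Domain_partial_perm[OF R] n by (intro card_subset_eq) simp_all
      \<comment> \<open>The identity outside [n], as \<open>permutes\<close> demands.\<close>
      define \<sigma> where "\<sigma> i = (if i \<in> {1..n} then THE v. (i, v) \<in> R else i)" for i
      have mem: "(i, v) \<in> R \<longleftrightarrow> i \<in> {1..n} \<and> v = \<sigma> i" for i v
      proof (cases "i \<in> {1..n}")
        case True
        then obtain w where w: "(i, w) \<in> R" using dom by blast
        have "(THE v. (i, v) \<in> R) = w"
          using w by (rule the_equality) (use w partial_permsD(2)[OF R] in blast)
        then have "\<sigma> i = w" using True by (simp add: \<sigma>_def)
        then show ?thesis using w True partial_permsD(2)[OF R] by blast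
      next
        case False
        then show ?thesis using dom by blast
      qed
      have "inj_on \<sigma> {1..n}"
      proof (rule inj_onI)
        fix i j assume "i \<in> {1..n}" "j \<in> {1..n}" and eq: "\<sigma> i = \<sigma> j"
        then have "(i, \<sigma> i) \<in> R" "(j, \<sigma> j) \<in> R" unfolding mem by simp_all
        then show "i = j" using partial_permsD(2)[OF R] eq by blast
      qed
      moreover have "\<sigma> ` {1..n} \<subseteq> {1..n}"
      proof
        fix y assume "y \<in> \<sigma> ` {1..n}"
        then obtain i where "(i, y) \<in> R" using mem by blast
        then show "y \<in> {1..n}" using partial_permsD(1)[OF R] by blast
      qed
      ultimately have "bij_betw \<sigma> {1..n} {1..n}"
        by (simp add: bij_betw_def endo_inj_surj)
      then have "\<sigma> \<in> Sym n"
        unfolding Sym_def mem_Collect_eq by (rule bij_imp_permutes) (auto simp: \<sigma>_def)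
      moreover have "R = perm_graph n \<sigma>"
        by (intro set_eqI) (simp only: split_paired_all mem in_perm_graph_iff)
      ultimately show "R \<in> perm_graph n ` Sym n"
        using image_eqI[of R "perm_graph n" \<sigma> "Sym n"] by simp
    qed
  qed
qed

section \<open>Reflection in the antidiagonal\<close>

definition antitranspose :: "nat \<Rightarrow> (nat \<times> nat) set \<Rightarrow> (nat \<times> nat) set" where
  "antitranspose n R = {(x, y). x \<in> {1..n} \<and> y \<in> {1..n} \<and> (n + 1 - y, n + 1 - x) \<in> R}"

lemma antitranspose_antitranspose:
  assumes "R \<in> partial_perms n" shows "antitranspose n (antitranspose n R) = R"
proof -
  have "(x, y) \<in> antitranspose n (antitranspose n R) \<longleftrightarrow> (x, y) \<in> R" for x y
    using partial_permsD(1)[OF assms, of x y] by (auto simp: antitranspose_def)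
  then show ?thesis by (intro set_eqI) (simp only: split_paired_all)
qed

lemma antitranspose_eq_image:
  assumes "R \<in> partial_perms n"
  shows "antitranspose n R = (\<lambda>(x, y). (n + 1 - y, n + 1 - x)) ` R"
proof (intro set_eqI iffI)
  fix p assume "p \<in> antitranspose n R"
  then show "p \<in> (\<lambda>(x, y). (n + 1 - y, n + 1 - x)) ` R"
    by (intro image_eqI[of _ _ "(n + 1 - snd p, n + 1 - fst p)"]) (auto simp: antitranspose_def)
next
  fix p assume "p \<in> (\<lambda>(x, y). (n + 1 - y, n + 1 - x)) ` R"
  then obtain x y where "(x, y) \<in> R" "p = (n + 1 - y, n + 1 - x)" by auto
  then show "p \<in> antitranspose n R"
    using partial_permsD(1)[OF assms, of x y] by (auto simp: antitranspose_def)
qed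

lemma card_antitranspose_filter:
  assumes R: "R \<in> partial_perms n"
    and Q: "\<And>x y. (x, y) \<in> R \<Longrightarrow> Q (n + 1 - y, n + 1 - x) \<longleftrightarrow> Q (x, y)"
  shows "card {p \<in> antitranspose n R. Q p} = card {p \<in> R. Q p}"
proof -
  let ?r = "\<lambda>(x, y). (n + 1 - y, n + 1 - x)"
  have inj: "inj_on ?r R"
  proof (rule inj_onI)
    fix p p' assume p: "p \<in> R" "p' \<in> R" and eq: "?r p = ?r p'"
    obtain x y x' y' where xy: "p = (x, y)" "p' = (x', y')" by fastforce
    show "p = p'"
      using eq partial_permsD(1)[OF R, of x y] partial_permsD(1)[OF R, of x' y'] p unfolding xy by auto
  qed
  have "{p \<in> antitranspose n R. Q p} = ?r ` {p \<in> R. Q p}"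
    unfolding antitranspose_eq_image[OF R] using Q by auto
  then show ?thesis
    using card_image[OF inj_on_subset[OF inj, of "{p \<in> R. Q p}"]] by simp
qed

lemma antitranspose_partial_perm:
  assumes R: "R \<in> partial_perms n" shows "antitranspose n R \<in> partial_perms n"
proof (rule partial_permsI)
  fix a b c d
  show "a \<in> {1..n} \<and> b \<in> {1..n}" if "(a, b) \<in> antitranspose n R"
    using that by (simp add: antitranspose_def)
  show "a = c \<longleftrightarrow> b = d" if "(a, b) \<in> antitranspose n R" "(c, d) \<in> antitranspose n R"
    using that partial_permsD(2)[OF R, of "n + 1 - b" "n + 1 - a" "n + 1 - d" "n + 1 - c"]
    by (auto simp: antitranspose_def)
qed

text \<open>The reflection reverses the order of the numbers and swaps the two ends of an edge, so
  \<open>x < y\<close> and \<open>x = y\<close> both survive.\<close>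

lemma antitranspose_stats:
  assumes R: "R \<in> partial_perms n"
  shows "card (antitranspose n R) = card R" "exc_pairs (antitranspose n R) = exc_pairs R"
    "fix_pairs (antitranspose n R) = fix_pairs R"
proof -
  have bounds: "x \<le> n" "y \<le> n" if "(x, y) \<in> R" for x y
    using partial_permsD(1)[OF R that] by auto
  show "card (antitranspose n R) = card R"
    using card_antitranspose_filter[OF R, of "\<lambda>_. True"] by simp
  show "exc_pairs (antitranspose n R) = exc_pairs R"
    unfolding exc_pairs_def by (rule card_antitranspose_filter[OF R]) (use bounds in fastforce)
  show "fix_pairs (antitranspose n R) = fix_pairs R"
    unfolding fix_pairs_def by (rule card_antitranspose_filter[OF R]) (use bounds in fastforce)
qed

lemma bij_betw_antitranspose:
  "bij_betw (antitranspose n) {R \<in> partial_perms n. card R = n} {R \<in> partial_perms n. card R = n}"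
  by (rule bij_betw_byWitness[where f' = "antitranspose n"])
    (auto simp: antitranspose_antitranspose antitranspose_partial_perm antitranspose_stats)

section \<open>Reading exc, fix, ear and pex off the graph\<close>

lemma exc_pairs_perm_graph: "exc_pairs (perm_graph n \<sigma>) = exc n \<sigma>"
proof -
  have "{p \<in> perm_graph n \<sigma>. fst p < snd p} = (\<lambda>i. (i, \<sigma> i)) ` {i. excedance n \<sigma> i}"
    by (auto simp: perm_graph_def excedance_def)
  then show ?thesis
    unfolding exc_pairs_def exc_def by (simp add: card_image inj_on_def)
qed

lemma fix_pairs_perm_graph: "fix_pairs (perm_graph n \<sigma>) = fixpts n \<sigma>"
proof -
  have "{p \<in> perm_graph n \<sigma>. fst p = snd p} = (\<lambda>i. (i, \<sigma> i)) ` {i \<in> {1..n}. \<sigma> i = i}"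
    by (auto simp: perm_graph_def)
  then show ?thesis
    unfolding fix_pairs_def fixpts_def by (simp add: card_image inj_on_def)
qed

lemma Sym_surj:
  assumes "\<sigma> \<in> Sym n" "v \<in> {1..n}"
  obtains i where "i \<in> {1..n}" "\<sigma> i = v"
proof -
  have "\<sigma> ` {1..n} = {1..n}" using assms(1) by (simp add: Sym_def permutes_image)
  then have "v \<in> \<sigma> ` {1..n}" using assms(2) by simp
  then show thesis using that by (elim imageE) simp
qed

lemma in_marked_peaks_perm_graph_iff:
  "k \<in> marked_peaks P (perm_graph n \<sigma>) \<longleftrightarrow> k \<in> {1..n} \<and> \<sigma> k \<in> {1..<k} \<and>
    (\<exists>i\<in>{1..<k}. i \<in> {1..n} \<and> \<sigma> i = k \<and> P (perm_graph n \<sigma> \<inter> {1..<k} \<times> {1..<k}) k i (\<sigma> k))"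
  unfolding marked_peaks_def mem_Collect_eq in_perm_graph_iff
proof
  assume "\<exists>i\<in>{1..<k}. \<exists>v\<in>{1..<k}. (i \<in> {1..n} \<and> k = \<sigma> i) \<and> (k \<in> {1..n} \<and> v = \<sigma> k) \<and>
    P (perm_graph n \<sigma> \<inter> {1..<k} \<times> {1..<k}) k i v"
  then obtain i v where "i \<in> {1..<k}" "v \<in> {1..<k}" "i \<in> {1..n}" "k = \<sigma> i" "k \<in> {1..n}" "v = \<sigma> k"
    "P (perm_graph n \<sigma> \<inter> {1..<k} \<times> {1..<k}) k i v" by (elim bexE conjE)
  then show "k \<in> {1..n} \<and> \<sigma> k \<in> {1..<k} \<and>
    (\<exists>i\<in>{1..<k}. i \<in> {1..n} \<and> \<sigma> i = k \<and> P (perm_graph n \<sigma> \<inter> {1..<k} \<times> {1..<k}) k i (\<sigma> k))"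
    by (intro conjI bexI[of _ i]) simp_all
next
  assume "k \<in> {1..n} \<and> \<sigma> k \<in> {1..<k} \<and>
    (\<exists>i\<in>{1..<k}. i \<in> {1..n} \<and> \<sigma> i = k \<and> P (perm_graph n \<sigma> \<inter> {1..<k} \<times> {1..<k}) k i (\<sigma> k))"
  then obtain i where "k \<in> {1..n}" "\<sigma> k \<in> {1..<k}" "i \<in> {1..<k}" "i \<in> {1..n}" "\<sigma> i = k"
    "P (perm_graph n \<sigma> \<inter> {1..<k} \<times> {1..<k}) k i (\<sigma> k)" by (elim bexE conjE)
  then show "\<exists>i\<in>{1..<k}. \<exists>v\<in>{1..<k}. (i \<in> {1..n} \<and> k = \<sigma> i) \<and> (k \<in> {1..n} \<and> v = \<sigma> k) \<and>
    P (perm_graph n \<sigma> \<inter> {1..<k} \<times> {1..<k}) k i v"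
    by (intro bexI[of _ i] bexI[of _ "\<sigma> k"] conjI) simp_all
qed

text \<open>All values below \<open>\<sigma> k\<close> come from positions before \<open>k\<close>
  exactly if none comes from a later one, that is, if \<open>k\<close> is an antirecord.
  Exclusiveness is automatic at a cycle peak.\<close>

lemma marked_peaks_perm_graph:
  assumes \<sigma>: "\<sigma> \<in> Sym n"
  shows "marked_peaks min_value_mark (perm_graph n \<sigma>) =
    {k. exclusive_antirecord n \<sigma> k \<and> cycle_peak n \<sigma> k}"
proof (rule set_eqI)
  fix k
  have inv: "inv \<sigma> v = i" if "\<sigma> i = v" for i v
    using that permutes_inverses(2)[of \<sigma> "{1..n}" i] \<sigma> unfolding Sym_def by simp
  show "k \<in> marked_peaks min_value_mark (perm_graph n \<sigma>) \<longleftrightarrow>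
    k \<in> {k. exclusive_antirecord n \<sigma> k \<and> cycle_peak n \<sigma> k}"
  proof
    assume "k \<in> marked_peaks min_value_mark (perm_graph n \<sigma>)"
    then obtain i where i: "i \<in> {1..<k}" "\<sigma> i = k" "i \<in> {1..n}"
      and k: "k \<in> {1..n}" "\<sigma> k \<in> {1..<k}"
      and mark: "{1..<\<sigma> k} \<subseteq> Range (perm_graph n \<sigma> \<inter> {1..<k} \<times> {1..<k})"
      unfolding in_marked_peaks_perm_graph_iff min_value_mark_def by (elim conjE bexE)
    have "\<sigma> k < \<sigma> j" if j: "j \<in> {k<..n}" for j
    proof (rule ccontr)
      assume "\<not> \<sigma> k < \<sigma> j"
      moreover have "\<sigma> j \<noteq> \<sigma> k" using Sym_inj[OF \<sigma>] j by simp
      moreover have "\<sigma> j \<in> {1..n}" using Sym_image[OF \<sigma>, of j] j by simp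
      ultimately have "\<sigma> j \<in> {1..<\<sigma> k}" by simp
      then have "\<sigma> j \<in> Range (perm_graph n \<sigma> \<inter> {1..<k} \<times> {1..<k})" by (rule subsetD[OF mark])
      then obtain l where "l < k" "\<sigma> l = \<sigma> j" unfolding Range_iff Int_iff in_perm_graph_iff by auto
      then show False using Sym_inj[OF \<sigma>] j by simp
    qed
    then have "antirecord n \<sigma> k" using k by (simp add: antirecord_def)
    \<comment> \<open>The preimage \<open>i\<close> of \<open>k\<close> lies before \<open>k\<close>
      and carries the value \<open>k\<close>, which exceeds \<open>\<sigma> k\<close>.\<close>
    moreover have "\<not> is_record n \<sigma> k"
    proof
      assume "is_record n \<sigma> k"
      then have "\<sigma> i < \<sigma> k" using i(1) unfolding is_record_def by blast
      then show False using i(2) k(2) by simp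
    qed
    moreover have "cycle_peak n \<sigma> k"
      using inv[OF i(2)] i k by (simp add: cycle_peak_def)
    ultimately show "k \<in> {k. exclusive_antirecord n \<sigma> k \<and> cycle_peak n \<sigma> k}"
      by (simp add: exclusive_antirecord_def)
  next
    assume "k \<in> {k. exclusive_antirecord n \<sigma> k \<and> cycle_peak n \<sigma> k}"
    then have k: "k \<in> {1..n}" and anti: "\<And>j. j \<in> {k<..n} \<Longrightarrow> \<sigma> k < \<sigma> j"
      and peak: "inv \<sigma> k < k" "\<sigma> k < k"
      by (simp_all add: exclusive_antirecord_def antirecord_def cycle_peak_def)
    obtain i where i: "i \<in> {1..n}" "\<sigma> i = k" using Sym_surj[OF \<sigma> k] .
    have "i < k" using peak(1) inv[OF i(2)] by simp
    have "\<sigma> k \<in> {1..n}" using Sym_image[OF \<sigma>, of k] k by blast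
    have "{1..<\<sigma> k} \<subseteq> Range (perm_graph n \<sigma> \<inter> {1..<k} \<times> {1..<k})"
    proof
      fix w assume w: "w \<in> {1..<\<sigma> k}"
      then have wn: "w \<in> {1..n}" using \<open>\<sigma> k \<in> {1..n}\<close> by simp
      obtain j where j: "j \<in> {1..n}" "\<sigma> j = w" using Sym_surj[OF \<sigma> wn] .
      have "j \<noteq> k" using w j by auto
      moreover have "\<not> k < j" using anti[of j] w j by auto
      ultimately have "(j, w) \<in> perm_graph n \<sigma> \<inter> {1..<k} \<times> {1..<k}"
        using w j peak(2) by (simp add: in_perm_graph_iff)
      then show "w \<in> Range (perm_graph n \<sigma> \<inter> {1..<k} \<times> {1..<k})" by (rule RangeI)
    qed
    moreover have "i \<in> {1..<k}" "\<sigma> k \<in> {1..<k}"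
      using i \<open>i < k\<close> \<open>\<sigma> k \<in> {1..n}\<close> peak(2) by simp_all
    ultimately show "k \<in> marked_peaks min_value_mark (perm_graph n \<sigma>)"
      unfolding in_marked_peaks_perm_graph_iff min_value_mark_def using i k by (intro conjI bexI[of _ i])
  qed
qed

lemma in_antitranspose_perm_graph_iff:
  "(x, y) \<in> antitranspose n (perm_graph n \<sigma>) \<longleftrightarrow> x \<in> {1..n} \<and> y \<in> {1..n} \<and> \<sigma> (n + 1 - y) = n + 1 - x"
  by (auto simp: antitranspose_def in_perm_graph_iff)

text \<open>Put k = n + 1 - a. The reflected edge into \<open>k\<close> starts at i = n + 1 -
  \<sigma>(a), and a forbidden \<open>j\<close> reflects to a source above \<open>i\<close> and at
  most \<open>k\<close> whose value exceeds \<open>k\<close>. The endpoint \<open>a\<close> of the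
  interval corresponds to the source \<open>k\<close>, and excluding it makes \<open>k\<close> a
  cycle peak; excluding the values strictly inside gives the mark.\<close>

lemma marked_peaks_antitranspose_perm_graph:
  assumes \<sigma>: "\<sigma> \<in> Sym n" and a: "a \<in> {1..n}"
  shows "n + 1 - a \<in> marked_peaks max_source_mark (antitranspose n (perm_graph n \<sigma>)) \<longleftrightarrow>
    excedance n \<sigma> a \<and> (\<forall>j\<in>{1..<a}. \<sigma> j \<notin> {a..\<sigma> a})"
proof -
  let ?R = "antitranspose n (perm_graph n \<sigma>)"
  define k where "k = n + 1 - a"
  have k: "k \<in> {1..n}" and ka: "n + 1 - k = a" using a by (auto simp: k_def)
  have \<sigma>a: "\<sigma> a \<in> {1..n}" using Sym_image[OF \<sigma>, of a] a by blast
  show ?thesis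
    unfolding k_def[symmetric]
  proof
    assume "k \<in> marked_peaks max_source_mark ?R"
    then obtain i v where i: "i \<in> {1..<k}" "(i, k) \<in> ?R" and v: "v \<in> {1..<k}" "(k, v) \<in> ?R"
      and mark: "{i<..<k} \<subseteq> Domain (?R \<inter> {1..<k} \<times> {1..<k})"
      unfolding marked_peaks_def max_source_mark_def mem_Collect_eq by (elim bexE conjE)
    have ia: "\<sigma> a = n + 1 - i" using i(2) ka by (simp add: in_antitranspose_perm_graph_iff)
    have va: "\<sigma> (n + 1 - v) = a" using v(2) ka by (simp add: in_antitranspose_perm_graph_iff)
    have "a < \<sigma> a" using ia i(1) k ka by auto
    then have "excedance n \<sigma> a" using a by (simp add: excedance_def)
    moreover have "\<sigma> j \<notin> {a..\<sigma> a}" if j: "j \<in> {1..<a}" for j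
    proof
      assume mem: "\<sigma> j \<in> {a..\<sigma> a}"
      have "\<sigma> j \<noteq> \<sigma> a" using Sym_inj[OF \<sigma>] j by simp
      \<comment> \<open>The preimage of \<open>a\<close> is n + 1 - v, which lies to the right of
        \<open>a\<close> because \<open>v < k\<close>.\<close>
      moreover have "\<sigma> j \<noteq> a"
      proof
        assume "\<sigma> j = a"
        then have "j = n + 1 - v" using va Sym_inj[OF \<sigma>] by metis
        then show False using j v(1) k ka by auto
      qed
      \<comment> \<open>Strictly inside the interval, the mark gives the reflected source a value
        below \<open>k\<close>, which would put \<open>j\<close> to the right of
        \<open>a\<close>.\<close>
      ultimately have "n + 1 - \<sigma> j \<in> {i<..<k}" using mem ia i(1) k \<sigma>a by (auto simp: k_def)
      then have "n + 1 - \<sigma> j \<in> Domain (?R \<inter> {1..<k} \<times> {1..<k})" by (rule subsetD[OF mark])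
      then obtain y where y: "y \<in> {1..<k}" "(n + 1 - \<sigma> j, y) \<in> ?R" by auto
      have "n + 1 - (n + 1 - \<sigma> j) = \<sigma> j" using mem \<sigma>a by auto
      then have "\<sigma> (n + 1 - y) = \<sigma> j" using y(2) by (simp add: in_antitranspose_perm_graph_iff)
      then have "n + 1 - y = j" using Sym_inj[OF \<sigma>] by simp
      then show False using y(1) j k ka by auto
    qed
    ultimately show "excedance n \<sigma> a \<and> (\<forall>j\<in>{1..<a}. \<sigma> j \<notin> {a..\<sigma> a})" by simp
  next
    assume "excedance n \<sigma> a \<and> (\<forall>j\<in>{1..<a}. \<sigma> j \<notin> {a..\<sigma> a})"
    then have exc: "a < \<sigma> a" and pure: "\<And>j. j \<in> {1..<a} \<Longrightarrow> \<sigma> j \<notin> {a..\<sigma> a}"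
      by (simp_all add: excedance_def)
    \<comment> \<open>Applied to the value \<open>a\<close> itself, whose preimage gives the edge
      out of \<open>k\<close>, and to the values that reflect into \<open>{i<..<k}\<close>.\<close>
    have later: "a < e" if e: "e \<in> {1..n}" "\<sigma> e \<in> {a..<\<sigma> a}" for e
    proof (rule ccontr)
      assume "\<not> a < e"
      moreover have "e \<noteq> a" using e(2) by auto
      ultimately have "e \<in> {1..<a}" using e(1) by simp
      then show False using pure[of e] e(2) by simp
    qed
    define i where "i = n + 1 - \<sigma> a"
    have i: "i \<in> {1..<k}" using \<sigma>a exc a by (auto simp: i_def k_def)
    obtain b where b: "b \<in> {1..n}" "\<sigma> b = a" using Sym_surj[OF \<sigma> a] .
    then have "a < b" using later[of b] exc by simp
    have "(i, k) \<in> ?R" using i k \<sigma>a ka by (auto simp: in_antitranspose_perm_graph_iff i_def)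
    moreover have "n + 1 - b \<in> {1..<k}" using \<open>a < b\<close> b(1) by (auto simp: k_def)
    moreover have "(k, n + 1 - b) \<in> ?R" using b k ka by (auto simp: in_antitranspose_perm_graph_iff)
    moreover have "{i<..<k} \<subseteq> Domain (?R \<inter> {1..<k} \<times> {1..<k})"
    proof
      fix c assume c: "c \<in> {i<..<k}"
      then have d: "n + 1 - c \<in> {a<..<\<sigma> a}" using \<sigma>a a by (auto simp: i_def k_def)
      then have "n + 1 - c \<in> {1..n}" using \<sigma>a by auto
      with \<sigma> obtain e where e: "e \<in> {1..n}" "\<sigma> e = n + 1 - c" by (rule Sym_surj)
      then have "a < e" using later[of e] d by simp
      have "c \<in> {1..<k}" using c i by simp
      moreover have "n + 1 - e \<in> {1..<k}" using \<open>a < e\<close> e(1) by (auto simp: k_def)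
      moreover have "(c, n + 1 - e) \<in> ?R" using e c i k by (auto simp: in_antitranspose_perm_graph_iff)
      ultimately have "(c, n + 1 - e) \<in> ?R \<inter> {1..<k} \<times> {1..<k}" by simp
      then show "c \<in> Domain (?R \<inter> {1..<k} \<times> {1..<k})" by (rule DomainI)
    qed
    ultimately show "k \<in> marked_peaks max_source_mark ?R"
      unfolding marked_peaks_def max_source_mark_def mem_Collect_eq
      using i by (intro bexI[of _ i] bexI[of _ "n + 1 - b"] conjI)
  qed
qed

lemma card_marked_peaks_antitranspose_perm_graph:
  assumes \<sigma>: "\<sigma> \<in> Sym n"
  shows "card (marked_peaks max_source_mark (antitranspose n (perm_graph n \<sigma>))) = pex n \<sigma>"
proof -
  let ?M = "marked_peaks max_source_mark (antitranspose n (perm_graph n \<sigma>))"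
  let ?P = "{i. excedance n \<sigma> i \<and> (\<forall>j\<in>{1..<i}. \<sigma> j \<notin> {i..\<sigma> i})}"
  have M: "k \<in> {1..n}" if "k \<in> ?M" for k
    using that unfolding marked_peaks_def in_antitranspose_perm_graph_iff by blast
  have P: "i \<in> {1..n}" if "i \<in> ?P" for i
    using that by (simp add: excedance_def)
  have "bij_betw (\<lambda>k. n + 1 - k) ?P ?M"
  proof (rule bij_betw_byWitness[where f' = "\<lambda>k. n + 1 - k"])
    show "\<forall>i\<in>?P. n + 1 - (n + 1 - i) = i"
    proof
      fix i assume "i \<in> ?P"
      from P[OF this] show "n + 1 - (n + 1 - i) = i" by simp
    qed
    show "\<forall>k\<in>?M. n + 1 - (n + 1 - k) = k"
    proof
      fix k assume "k \<in> ?M"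
      from M[OF this] show "n + 1 - (n + 1 - k) = k" by simp
    qed
    show "(\<lambda>k. n + 1 - k) ` ?P \<subseteq> ?M"
    proof (rule image_subsetI)
      fix i assume i: "i \<in> ?P"
      then show "n + 1 - i \<in> ?M" using marked_peaks_antitranspose_perm_graph[OF \<sigma> P[OF i]] by blast
    qed
    show "(\<lambda>k. n + 1 - k) ` ?M \<subseteq> ?P"
    proof (rule image_subsetI)
      fix k assume k: "k \<in> ?M"
      have "n + 1 - k \<in> {1..n}" "n + 1 - (n + 1 - k) = k" using M[OF k] by auto
      then show "n + 1 - k \<in> ?P" using marked_peaks_antitranspose_perm_graph[OF \<sigma>, of "n + 1 - k"] k by simp
    qed
  qed
  then show ?thesis unfolding pex_def by (simp add: bij_betw_same_card)
qed

section \<open>From equal distributions to bijections\<close>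

lemma sum_complete_only_filter:
  "sum (stat_value P n (complete_only g)) (partial_perms n) =
    (\<Sum>R\<in>{R \<in> partial_perms n. card R = n}.
      g (int (exc_pairs R)) (int (card (marked_peaks P R))) (int (fix_pairs R)))"
proof -
  have "stat_value P n (complete_only g) R = (if card R = n then
      g (int (exc_pairs R)) (int (card (marked_peaks P R))) (int (fix_pairs R)) else 0)" for R
    by (simp add: stat_value_def complete_only_def)
  then show ?thesis
    by (simp add: sum.inter_filter[OF finite_partial_perms])
qed

text \<open>\<open>F\<close> will be the graph itself for ear and the reflected graph for
  pex.\<close>

lemma sum_word_value_eq:
  assumes P: "marking P" and bij: "bij_betw F (Sym n) {R \<in> partial_perms n. card R = n}"
  shows "sum (word_value n g) (Sym n) = (\<Sum>\<sigma>\<in>Sym n.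
      g (int (exc_pairs (F \<sigma>))) (int (card (marked_peaks P (F \<sigma>)))) (int (fix_pairs (F \<sigma>))))"
  unfolding sum_complete_only_eq_sum_word_value[OF P, symmetric] sum_complete_only_filter
  by (rule sum.reindex_bij_betw[OF bij, symmetric])

text \<open>Fibres over the same value have equal size, so bijections between them can be chosen and
  glued.\<close>

lemma exists_stat_preserving_bij:
  assumes A: "finite A" and B: "finite B"
    and card: "\<And>t. card {a \<in> A. f a = t} = card {b \<in> B. g b = t}"
  shows "\<exists>\<Phi>. bij_betw \<Phi> A B \<and> (\<forall>a\<in>A. g (\<Phi> a) = f a)"
proof -
  have "\<exists>\<phi>. bij_betw \<phi> {a \<in> A. f a = t} {b \<in> B. g b = t}" for t
    using A B card[of t] by (intro finite_same_card_bij) simp_all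
  then obtain \<phi> where \<phi>: "\<And>t. bij_betw (\<phi> t) {a \<in> A. f a = t} {b \<in> B. g b = t}" by metis
  define \<Phi> where "\<Phi> a = \<phi> (f a) a" for a
  have \<Phi>: "\<Phi> a \<in> B" "g (\<Phi> a) = f a" if "a \<in> A" for a
    using bij_betwE[OF \<phi>[of "f a"]] that by (simp_all add: \<Phi>_def)
  have "bij_betw \<Phi> A B"
  proof (rule bij_betw_imageI)
    show "inj_on \<Phi> A"
    proof (rule inj_onI)
      fix a a' assume a: "a \<in> A" "a' \<in> A" and eq: "\<Phi> a = \<Phi> a'"
      then have "f a = f a'" using \<Phi>(2) by metis
      then show "a = a'"
        using inj_onD[OF bij_betw_imp_inj_on[OF \<phi>[of "f a"]], of a a'] a eq by (simp add: \<Phi>_def)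
    qed
    show "\<Phi> ` A = B"
    proof
      show "\<Phi> ` A \<subseteq> B" using \<Phi>(1) by (rule image_subsetI)
      show "B \<subseteq> \<Phi> ` A"
      proof
        fix b assume "b \<in> B"
        then have "b \<in> \<phi> (g b) ` {a \<in> A. f a = g b}"
          using bij_betw_imp_surj_on[OF \<phi>[of "g b"]] by simp
        then obtain a where "a \<in> A" "f a = g b" "b = \<phi> (g b) a" by blast
        then show "b \<in> \<Phi> ` A" by (intro image_eqI[of _ _ a]) (simp_all add: \<Phi>_def)
      qed
    qed
  qed
  then show ?thesis using \<Phi>(2) by blast
qed

lemma exists_word_stat_bij:
  assumes P: "marking P" and bij: "bij_betw F (Sym n) {R \<in> partial_perms n. card R = n}"
  shows "\<exists>\<Phi>. bij_betw \<Phi> (Sym n) (Sym n) \<and> (\<forall>\<sigma>\<in>Sym n.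
    (exc_pairs (F (\<Phi> \<sigma>)), card (marked_peaks P (F (\<Phi> \<sigma>))), fix_pairs (F (\<Phi> \<sigma>))) =
    (des n \<sigma>, des2 n \<sigma>, fmax n \<sigma>))"
proof (rule exists_stat_preserving_bij[OF finite_Sym finite_Sym])
  fix t :: "nat \<times> nat \<times> nat"
  obtain e q f where t: "t = (e, q, f)" by (cases t)
  \<comment> \<open>The indicator of a single triple turns the equality of sums into an equality of
    fibre sizes.\<close>
  let ?g = "\<lambda>e' q' f'. if e' = int e \<and> q' = int q \<and> f' = int f then 1 else (0 :: int)"
  have count: "int (card {\<sigma> \<in> Sym n. s \<sigma> = t}) = (\<Sum>\<sigma>\<in>Sym n. if s \<sigma> = t then 1 else 0)"
    for s :: "(nat \<Rightarrow> nat) \<Rightarrow> nat \<times> nat \<times> nat"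
    unfolding sum.inter_filter[OF finite_Sym, symmetric] by simp
  have "int (card {\<sigma> \<in> Sym n. (des n \<sigma>, des2 n \<sigma>, fmax n \<sigma>) = t}) = sum (word_value n ?g) (Sym n)"
    unfolding count by (rule sum.cong) (simp_all add: word_value_def t)
  also have "\<dots> = int (card {\<sigma> \<in> Sym n. (exc_pairs (F \<sigma>), card (marked_peaks P (F \<sigma>)), fix_pairs (F \<sigma>)) = t})"
    unfolding sum_word_value_eq[OF P bij] count by (rule sum.cong) (simp_all add: t)
  finally show "card {\<sigma> \<in> Sym n. (des n \<sigma>, des2 n \<sigma>, fmax n \<sigma>) = t} =
      card {\<sigma> \<in> Sym n. (exc_pairs (F \<sigma>), card (marked_peaks P (F \<sigma>)), fix_pairs (F \<sigma>)) = t}"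
    by simp
qed

theorem theorem1p9:
  fixes n :: nat
  assumes "n \<ge> 1"
  shows "\<exists>\<Phi>\<^sub>1 \<Phi>\<^sub>2. bij_betw \<Phi>\<^sub>1 (Sym n) (Sym n) \<and> bij_betw \<Phi>\<^sub>2 (Sym n) (Sym n) \<and>
    (\<forall>\<sigma>\<in>Sym n.
      (des n \<sigma>, des2 n \<sigma>) = (exc n (\<Phi>\<^sub>1 \<sigma>), ear n (\<Phi>\<^sub>1 \<sigma>)) \<and>
      (des n \<sigma>, des2 n \<sigma>, fmax n \<sigma>) = (exc n (\<Phi>\<^sub>2 \<sigma>), pex n (\<Phi>\<^sub>2 \<sigma>), fixpts n (\<Phi>\<^sub>2 \<sigma>)))"
proof -
  obtain \<Phi>\<^sub>1 where \<Phi>\<^sub>1: "bij_betw \<Phi>\<^sub>1 (Sym n) (Sym n)"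
    and stats1: "\<And>\<sigma>. \<sigma> \<in> Sym n \<Longrightarrow>
      (exc_pairs (perm_graph n (\<Phi>\<^sub>1 \<sigma>)), card (marked_peaks min_value_mark (perm_graph n (\<Phi>\<^sub>1 \<sigma>))),
        fix_pairs (perm_graph n (\<Phi>\<^sub>1 \<sigma>))) = (des n \<sigma>, des2 n \<sigma>, fmax n \<sigma>)"
    using exists_word_stat_bij[OF marking_min_value bij_betw_perm_graph, of n] by blast
  obtain \<Phi>\<^sub>2 where \<Phi>\<^sub>2: "bij_betw \<Phi>\<^sub>2 (Sym n) (Sym n)"
    and stats2: "\<And>\<sigma>. \<sigma> \<in> Sym n \<Longrightarrow>
      (exc_pairs ((antitranspose n \<circ> perm_graph n) (\<Phi>\<^sub>2 \<sigma>)),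
        card (marked_peaks max_source_mark ((antitranspose n \<circ> perm_graph n) (\<Phi>\<^sub>2 \<sigma>))),
        fix_pairs ((antitranspose n \<circ> perm_graph n) (\<Phi>\<^sub>2 \<sigma>))) = (des n \<sigma>, des2 n \<sigma>, fmax n \<sigma>)"
    using exists_word_stat_bij[OF marking_max_source bij_betw_trans[OF bij_betw_perm_graph bij_betw_antitranspose]]
    by blast
  have "(des n \<sigma>, des2 n \<sigma>) = (exc n (\<Phi>\<^sub>1 \<sigma>), ear n (\<Phi>\<^sub>1 \<sigma>))" if \<sigma>: "\<sigma> \<in> Sym n" for \<sigma>
    using stats1[OF \<sigma>] marked_peaks_perm_graph[OF bij_betw_apply[OF \<Phi>\<^sub>1 \<sigma>]]
    by (simp add: exc_pairs_perm_graph ear_def)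
  moreover have "(des n \<sigma>, des2 n \<sigma>, fmax n \<sigma>) = (exc n (\<Phi>\<^sub>2 \<sigma>), pex n (\<Phi>\<^sub>2 \<sigma>), fixpts n (\<Phi>\<^sub>2 \<sigma>))"
    if \<sigma>: "\<sigma> \<in> Sym n" for \<sigma>
  proof -
    have \<tau>: "\<Phi>\<^sub>2 \<sigma> \<in> Sym n" by (rule bij_betw_apply[OF \<Phi>\<^sub>2 \<sigma>])
    \<comment> \<open>Reflection keeps excedances and fixed points and turns marked peaks into
      \<open>pex\<close>, so \<open>stats2\<close> becomes a statement about
      \<open>\<Phi>\<^sub>2 \<sigma>\<close> itself.\<close>
    show ?thesis
      using stats2[OF \<sigma>] antitranspose_stats[OF perm_graph_partial_perm[OF \<tau>]]
        card_marked_peaks_antitranspose_perm_graph[OF \<tau>]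
      by (simp add: exc_pairs_perm_graph fix_pairs_perm_graph)
  qed
  ultimately show ?thesis using \<Phi>\<^sub>1 \<Phi>\<^sub>2 by blast
qed

end
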